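(* Let $L/K$ be a wildly and weakly ramified finite Galois extension of complete local fields with finite residue fields, let $G=\mathrm{Gal}(L/K)$, and let $\pi_K$ be any uniformizer of $K$. Then $\mathfrak{A}_{L/K}=\mathcal{O}_K[G][\pi_K^{-1}\mathrm{Tr}_{G_0}]$, and every free generator of $\mathfrak{P}_L$ over $\mathcal{O}_K[G]$ is also a free generator of $\mathcal{O}_L$ over $\mathfrak{A}_{L/K}$. *)

theory Defs
  imports Main
begin

text \<open>Setting: the top field L is a type 'a::field, equipped with a normalized
discrete valuation v :: 'a => int (only meaningful on nonzero elements).
The base field K is a subset of L.  Elements of the group ring K[G] are
functions G -> K (extended by 0 outside G).\<close>

definition vge :: "('a::field \<Rightarrow> int) \<Rightarrow> int \<Rightarrow> 'a \<Rightarrow> bool" where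
  "vge v n x \<longleftrightarrow> x = 0 \<or> v x \<ge> n"

definition val_ring :: "('a::field \<Rightarrow> int) \<Rightarrow> 'a set" where
  "val_ring v = {x. vge v 0 x}"

definition val_ideal :: "('a::field \<Rightarrow> int) \<Rightarrow> 'a set" where
  "val_ideal v = {x. vge v 1 x}"

definition discrete_valuation :: "('a::field \<Rightarrow> int) \<Rightarrow> bool" where
  "discrete_valuation v \<longleftrightarrow>
     (\<forall>x y. x \<noteq> 0 \<longrightarrow> y \<noteq> 0 \<longrightarrow> v (x * y) = v x + v y) \<and>
     (\<forall>x y. x \<noteq> 0 \<longrightarrow> y \<noteq> 0 \<longrightarrow> x + y \<noteq> 0 \<longrightarrow> v (x + y) \<ge> min (v x) (v y)) \<and>
     (\<exists>x. x \<noteq> 0 \<and> v x = 1)"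

definition cauchy_v :: "('a::field \<Rightarrow> int) \<Rightarrow> (nat \<Rightarrow> 'a) \<Rightarrow> bool" where
  "cauchy_v v s \<longleftrightarrow> (\<forall>n. \<exists>N. \<forall>i\<ge>N. \<forall>j\<ge>N. vge v n (s i - s j))"

definition converges_v :: "('a::field \<Rightarrow> int) \<Rightarrow> (nat \<Rightarrow> 'a) \<Rightarrow> 'a \<Rightarrow> bool" where
  "converges_v v s l \<longleftrightarrow> (\<forall>n. \<exists>N. \<forall>i\<ge>N. vge v n (s i - l))"

definition local_field_val :: "('a::field \<Rightarrow> int) \<Rightarrow> bool" where
  "local_field_val v \<longleftrightarrow> discrete_valuation v \<and>
     (\<forall>s. cauchy_v v s \<longrightarrow> (\<exists>l. converges_v v s l)) \<and>
     (\<exists>R. finite R \<and> (\<forall>x\<in>val_ring v. \<exists>r\<in>R. x - r \<in> val_ideal v))"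

definition is_subfield :: "'a::field set \<Rightarrow> bool" where
  "is_subfield K \<longleftrightarrow> 0 \<in> K \<and> 1 \<in> K \<and>
     (\<forall>x\<in>K. \<forall>y\<in>K. x + y \<in> K \<and> x * y \<in> K) \<and>
     (\<forall>x\<in>K. - x \<in> K \<and> inverse x \<in> K)"

text \<open>K is a complete local field for the restricted valuation: a subfield
on which v is nontrivial and which is closed (hence complete) in L.\<close>
definition local_subfield :: "('a::field \<Rightarrow> int) \<Rightarrow> 'a set \<Rightarrow> bool" where
  "local_subfield v K \<longleftrightarrow> is_subfield K \<and>
     (\<exists>x\<in>K. x \<noteq> 0 \<and> v x \<noteq> 0) \<and>
     (\<forall>s l. (\<forall>i. s i \<in> K) \<longrightarrow> cauchy_v v s \<longrightarrow> converges_v v s l \<longrightarrow> l \<in> K)"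

definition finite_ext :: "'a::field set \<Rightarrow> bool" where
  "finite_ext K \<longleftrightarrow> (\<exists>B. finite B \<and>
     (\<forall>x. \<exists>c. (\<forall>b\<in>B. c b \<in> K) \<and> x = (\<Sum>b\<in>B. c b * b)))"

definition Gal :: "'a::field set \<Rightarrow> ('a \<Rightarrow> 'a) set" where
  "Gal K = {\<sigma>. bij \<sigma> \<and> (\<forall>x y. \<sigma> (x + y) = \<sigma> x + \<sigma> y \<and> \<sigma> (x * y) = \<sigma> x * \<sigma> y)
              \<and> (\<forall>k\<in>K. \<sigma> k = k)}"

definition galois_ext :: "'a::field set \<Rightarrow> bool" where
  "galois_ext K \<longleftrightarrow> finite_ext K \<and> (\<forall>x. (\<forall>\<sigma>\<in>Gal K. \<sigma> x = x) \<longrightarrow> x \<in> K)"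

definition ram_group :: "('a::field \<Rightarrow> int) \<Rightarrow> 'a set \<Rightarrow> int \<Rightarrow> ('a \<Rightarrow> 'a) set" where
  "ram_group v K i = {\<sigma>\<in>Gal K. \<forall>x\<in>val_ring v. vge v (i + 1) (\<sigma> x - x)}"

definition wildly_ramified :: "('a::field \<Rightarrow> int) \<Rightarrow> 'a set \<Rightarrow> bool" where
  "wildly_ramified v K \<longleftrightarrow> ram_group v K 1 \<noteq> {id}"

definition weakly_ramified :: "('a::field \<Rightarrow> int) \<Rightarrow> 'a set \<Rightarrow> bool" where
  "weakly_ramified v K \<longleftrightarrow> ram_group v K 2 = {id}"

definition uniformizer :: "('a::field \<Rightarrow> int) \<Rightarrow> 'a set \<Rightarrow> 'a \<Rightarrow> bool" where
  "uniformizer v K p \<longleftrightarrow> p \<in> K \<and> p \<noteq> 0 \<and> v p > 0 \<and>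
     (\<forall>y\<in>K. y \<noteq> 0 \<longrightarrow> v y > 0 \<longrightarrow> v p \<le> v y)"

definition grp_ring :: "'a::field set \<Rightarrow> ('a \<Rightarrow> 'a) set \<Rightarrow> (('a \<Rightarrow> 'a) \<Rightarrow> 'a) set" where
  "grp_ring R G = {f. (\<forall>\<sigma>\<in>G. f \<sigma> \<in> R) \<and> (\<forall>\<sigma>. \<sigma> \<notin> G \<longrightarrow> f \<sigma> = 0)}"

definition grp_mult :: "('a \<Rightarrow> 'a) set \<Rightarrow> (('a \<Rightarrow> 'a) \<Rightarrow> 'a::field) \<Rightarrow> (('a \<Rightarrow> 'a) \<Rightarrow> 'a) \<Rightarrow> (('a \<Rightarrow> 'a) \<Rightarrow> 'a)" where
  "grp_mult G a b = (\<lambda>\<tau>. if \<tau> \<in> G then (\<Sum>\<sigma>\<in>G. a \<sigma> * b (inv \<sigma> \<circ> \<tau>)) else 0)"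

definition grp_act :: "('a \<Rightarrow> 'a) set \<Rightarrow> (('a \<Rightarrow> 'a) \<Rightarrow> 'a::field) \<Rightarrow> 'a \<Rightarrow> 'a" where
  "grp_act G a x = (\<Sum>\<sigma>\<in>G. a \<sigma> * \<sigma> x)"

definition assoc_order :: "('a::field \<Rightarrow> int) \<Rightarrow> 'a set \<Rightarrow> (('a \<Rightarrow> 'a) \<Rightarrow> 'a) set" where
  "assoc_order v K = {a\<in>grp_ring K (Gal K). \<forall>x\<in>val_ring v. grp_act (Gal K) a x \<in> val_ring v}"

inductive_set gen_alg :: "('a \<Rightarrow> 'a) set \<Rightarrow> (('a \<Rightarrow> 'a) \<Rightarrow> 'a::field) set \<Rightarrow> (('a \<Rightarrow> 'a) \<Rightarrow> 'a) \<Rightarrow> (('a \<Rightarrow> 'a) \<Rightarrow> 'a) set"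
  for G R0 t where
  base: "a \<in> R0 \<Longrightarrow> a \<in> gen_alg G R0 t"
| gen: "t \<in> gen_alg G R0 t"
| add: "a \<in> gen_alg G R0 t \<Longrightarrow> b \<in> gen_alg G R0 t \<Longrightarrow> (\<lambda>\<sigma>. a \<sigma> + b \<sigma>) \<in> gen_alg G R0 t"
| mult: "a \<in> gen_alg G R0 t \<Longrightarrow> b \<in> gen_alg G R0 t \<Longrightarrow> grp_mult G a b \<in> gen_alg G R0 t"

definition scaled_trace :: "'a::field \<Rightarrow> ('a \<Rightarrow> 'a) set \<Rightarrow> (('a \<Rightarrow> 'a) \<Rightarrow> 'a)" where
  "scaled_trace p H = (\<lambda>\<sigma>. if \<sigma> \<in> H then inverse p else 0)"

definition free_generator :: "('a \<Rightarrow> 'a) set \<Rightarrow> (('a \<Rightarrow> 'a) \<Rightarrow> 'a::field) set \<Rightarrow> 'a set \<Rightarrow> 'a \<Rightarrow> bool" where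
  "free_generator G A M \<alpha> \<longleftrightarrow> bij_betw (\<lambda>a. grp_act G a \<alpha>) A M"

end

theory Submission
  imports Defs "HOL-Computational_Algebra.Polynomial" "HOL-Computational_Algebra.Primes" "HOL-Library.FuncSet"
begin

text \<open>
  Write \<open>O\<close> and \<open>P\<close> for the valuation ring of \<open>L\<close> and its maximal ideal, \<open>\<pi>\<close> for a uniformizer
  of \<open>L\<close>, and \<open>G\<^sub>i\<close> for \<open>ram i\<close>. The key fact is that the reduction of \<open>O\<^sub>K[G]\<close> modulo \<open>p\<close> acts
  faithfully on \<open>P / p P\<close>. Since \<open>G\<^sub>1\<close> is elementary abelian of residue characteristic, a nonzero
  annihilator could be chosen invariant under \<open>G\<^sub>1\<close>; evaluating it on \<open>w * y\<close>, with \<open>w\<close> fixed by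
  \<open>G\<^sub>1\<close> and \<open>y\<close> of \<open>G\<^sub>1\<close>-trace one, yields a linear relation between the characters
  \<open>w \<mapsto> \<sigma> w / w\<close> modulo \<open>P\<close>, which are distinct for distinct cosets of \<open>G\<^sub>1\<close>, contradicting
  Artin's theorem. Here weak ramification bounds \<open>v y\<close> from below so that \<open>w * y\<close> lies in \<open>P\<close>.

  If \<open>a\<close> maps \<open>O\<close> to itself, faithfulness gives first \<open>p a \<in> O\<^sub>K[G]\<close>, and then, as \<open>G\<^sub>0\<close> acts
  trivially on \<open>O / P\<close>, that \<open>p a\<close> is modulo \<open>p\<close> a multiple of the trace element of \<open>G\<^sub>0\<close>.
  Conversely, wild ramification forces the \<open>G\<^sub>0\<close>-trace of \<open>O\<close> into \<open>p O\<close>. Finally some element of \<open>P\<close>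
  has \<open>G\<^sub>0\<close>-trace \<open>p\<close>, so that \<open>O = P + p\<^sup>-\<^sup>1 Tr P\<close>, which transports free generators.
\<close>

section \<open>Interpolation and finite difference identities\<close>

text \<open>Lagrange interpolation at the nodes \<open>f s\<close> reproduces the monomial of degree
  \<open>i\<close>, and the claim compares coefficients in degree \<open>card S - 1\<close>. With
  conjugates of \<open>\<pi>\<close> as nodes it serves both for Euler's trace formula and for
  bounding valuations of fixed elements.\<close>

lemma lagrange_power_sum:
  fixes f :: "'b \<Rightarrow> 'a::field"
  assumes "finite S" "inj_on f S" "i < card S"
  shows "(\<Sum>s\<in>S. f s ^ i / (\<Prod>t\<in>S - {s}. f s - f t)) = (if Suc i = card S then 1 else 0)"
proof -
  define c where "c s = f s ^ i / (\<Prod>t\<in>S - {s}. f s - f t)" for s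
  define q where "q s = (\<Prod>t\<in>S - {s}. [:- f t, 1:])" for s
  define Q where "Q = (\<Sum>s\<in>S. smult (c s) (q s)) - monom 1 i"
  have deg_q: "degree (q s) = card S - 1" if "s \<in> S" for s
    unfolding q_def using that assms(1) by (subst degree_prod_eq_sum_degree) auto
  have lead_q: "coeff (q s) (card S - 1) = 1" if "s \<in> S" for s
  proof -
    have "lead_coeff (q s) = 1"
      unfolding q_def by (simp add: lead_coeff_prod)
    then show ?thesis using deg_q[OF that] by simp
  qed
  have "degree Q \<le> card S - 1"
    unfolding Q_def
  proof (intro degree_diff_le degree_sum_le)
    show "degree (smult (c s) (q s)) \<le> card S - 1" if "s \<in> S" for s
      using deg_q[OF that] degree_smult_le[of "c s" "q s"] by simp
  qed (use assms in \<open>auto simp: degree_monom_eq\<close>)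
  then have deg: "degree Q < card S" using assms(3) by linarith
  have root: "poly Q (f r) = 0" if r: "r \<in> S" for r
  proof -
    have "poly (q s) (f r) = 0" if "s \<in> S" "s \<noteq> r" for s
      unfolding q_def poly_prod using that r assms(1) by (intro prod_zero) auto
    moreover have "poly (q r) (f r) = (\<Prod>t\<in>S - {r}. f r - f t)"
      unfolding q_def poly_prod by (intro prod.cong) auto
    moreover have "(\<Prod>t\<in>S - {r}. f r - f t) \<noteq> 0"
      using assms(1,2) r by (auto simp: inj_on_def)
    moreover have "(\<Sum>s\<in>S. c s * poly (q s) (f r)) = (\<Sum>s\<in>S. if s = r then c r * poly (q r) (f r) else 0)"
      using calculation(1) by (intro sum.cong) auto
    ultimately show ?thesis
      using assms(1) r by (simp add: Q_def poly_sum poly_monom c_def)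
  qed
  have "Q = 0"
  proof (rule ccontr)
    assume "Q \<noteq> 0"
    then have "card {x. poly Q x = 0} \<le> degree Q" "finite {x. poly Q x = 0}"
      by (auto simp: card_poly_roots_bound poly_roots_finite)
    moreover have "card (f ` S) \<le> card {x. poly Q x = 0}"
      using root calculation(2) by (intro card_mono) auto
    ultimately show False using deg assms(2) by (simp add: card_image)
  qed
  then have "coeff (\<Sum>s\<in>S. smult (c s) (q s)) (card S - 1) = coeff (monom 1 i) (card S - 1)"
    by (simp add: Q_def)
  moreover have "coeff (\<Sum>s\<in>S. smult (c s) (q s)) (card S - 1) = (\<Sum>s\<in>S. c s)"
    using lead_q by (simp add: coeff_sum cong: sum.cong)
  ultimately have "(\<Sum>s\<in>S. c s) = (if i = card S - 1 then 1 else 0)"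
    by auto
  then show ?thesis using assms(3) unfolding c_def by auto
qed

text \<open>Needed for prime \<open>k = q\<close>: modulo \<open>q\<close> only the two end terms
  survive, which makes the operators \<open>shift g\<close> nilpotent.\<close>

lemma iterated_difference:
  fixes f :: "nat \<Rightarrow> 'a::comm_ring_1"
  shows "((\<lambda>f n. f (Suc n) - f n) ^^ k) f i = (\<Sum>j\<le>k. of_nat (k choose j) * (-1) ^ (k - j) * f (i + j))"
proof (induction k arbitrary: i)
  case (Suc k)
  let ?c = "\<lambda>k j. of_nat (k choose j) * (-1) ^ (k - j) :: 'a"
  have "((\<lambda>f n. f (Suc n) - f n) ^^ Suc k) f i
      = (\<Sum>j\<le>k. ?c k j * f (Suc i + j)) - (\<Sum>j\<le>k. ?c k j * f (i + j))"
    by (simp add: Suc.IH)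
  also have "(\<Sum>j\<le>k. ?c k j * f (i + j)) = (\<Sum>j\<le>Suc k. ?c k j * f (i + j))"
    by (simp add: binomial_eq_0)
  also have "\<dots> = (-1) ^ k * f i + (\<Sum>j\<le>k. ?c k (Suc j) * f (Suc i + j))"
    by (subst sum.atMost_Suc_shift) simp
  also have "(\<Sum>j\<le>k. ?c k j * f (Suc i + j)) - \<dots>
      = (-1) ^ Suc k * f i + (\<Sum>j\<le>k. (?c k j - ?c k (Suc j)) * f (Suc i + j))"
    by (simp add: sum_subtractf left_diff_distrib)
  also have "(\<Sum>j\<le>k. (?c k j - ?c k (Suc j)) * f (Suc i + j))
      = (\<Sum>j\<le>k. ?c (Suc k) (Suc j) * f (Suc i + j))"
  proof (intro sum.cong refl)
    fix j assume "j \<in> {..k}"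
    \<comment> \<open>The case \<open>j = k\<close> stands apart because \<open>k - Suc j\<close> is
      then truncated; its coefficient \<open>k choose Suc j\<close> vanishes.\<close>
    then consider "j = k" | "k - j = Suc (k - Suc j)" by fastforce
    then show "(?c k j - ?c k (Suc j)) * f (Suc i + j) = ?c (Suc k) (Suc j) * f (Suc i + j)"
      by cases (simp_all add: binomial_eq_0 algebra_simps)
  qed
  also have "(-1) ^ Suc k * f i + \<dots> = (\<Sum>j\<le>Suc k. ?c (Suc k) j * f (i + j))"
    by (subst sum.atMost_Suc_shift) (simp del: binomial_Suc_Suc)
  finally show ?case .
qed simp

section \<open>Discrete valuations and congruences modulo powers of the maximal ideal\<close>

locale discretely_valued =
  fixes v :: "'a::field \<Rightarrow> int"
  assumes dv: "discrete_valuation v"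
begin

abbreviation ge :: "int \<Rightarrow> 'a \<Rightarrow> bool" where "ge \<equiv> vge v"

lemma v_mult: "x \<noteq> 0 \<Longrightarrow> y \<noteq> 0 \<Longrightarrow> v (x * y) = v x + v y"
  using dv unfolding discrete_valuation_def by blast

lemma v_1 [simp]: "v 1 = 0"
  using v_mult[of 1 1] by simp

lemma v_uminus [simp]: "v (- x) = v x"
proof (cases "x = 0")
  case False
  have "v (-1) = 0" using v_mult[of "-1" "-1"] by simp
  then show ?thesis using v_mult[of "-1" x] False by simp
qed simp

lemma v_inverse: "x \<noteq> 0 \<Longrightarrow> v (inverse x) = - v x"
  using v_mult[of x "inverse x"] by simp

lemma v_divide: "x \<noteq> 0 \<Longrightarrow> y \<noteq> 0 \<Longrightarrow> v (x / y) = v x - v y"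
  by (simp add: divide_inverse v_mult v_inverse)

lemma v_power: "x \<noteq> 0 \<Longrightarrow> v (x ^ n) = int n * v x"
  by (induction n) (auto simp: v_mult algebra_simps)

lemma v_prod: "finite A \<Longrightarrow> (\<And>a. a \<in> A \<Longrightarrow> f a \<noteq> 0) \<Longrightarrow> v (\<Prod>a\<in>A. f a) = (\<Sum>a\<in>A. v (f a))"
  by (induction A rule: finite_induct) (auto simp: v_mult)

lemma ge_0 [simp]: "ge n 0" by (simp add: vge_def)

lemma ge_1 [simp]: "ge n 1 \<longleftrightarrow> n \<le> 0" by (simp add: vge_def)

lemma not_geD: "\<not> ge n x \<Longrightarrow> x \<noteq> 0 \<and> v x < n" by (auto simp: vge_def)

lemma ge_mono: "ge n x \<Longrightarrow> m \<le> n \<Longrightarrow> ge m x" by (auto simp: vge_def)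

lemma ge_add: "ge n x \<Longrightarrow> ge n y \<Longrightarrow> ge n (x + y)"
proof (cases "x = 0 \<or> y = 0 \<or> x + y = 0")
  case False
  assume "ge n x" "ge n y"
  moreover have "v (x + y) \<ge> min (v x) (v y)"
    using dv False unfolding discrete_valuation_def by blast
  ultimately show ?thesis using False by (auto simp: vge_def)
qed (auto simp: vge_def)

lemma ge_uminus [simp]: "ge n (- x) \<longleftrightarrow> ge n x" by (auto simp: vge_def)

lemma ge_diff: "ge n x \<Longrightarrow> ge n y \<Longrightarrow> ge n (x - y)"
  using ge_add[of n x "- y"] by simp

lemma ge_minus_commute: "ge n (x - y) \<longleftrightarrow> ge n (y - x)"
  using ge_uminus[of n "x - y"] by (simp del: ge_uminus)

lemma ge_trans: "ge n (x - y) \<Longrightarrow> ge n (y - z) \<Longrightarrow> ge n (x - z)"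
  using ge_add[of n "x - y" "y - z"] by simp

lemma ge_mult: "ge m x \<Longrightarrow> ge n y \<Longrightarrow> ge (m + n) (x * y)"
  by (cases "x = 0"; cases "y = 0") (auto simp: vge_def v_mult)

lemma ge_mult_left: "ge 0 x \<Longrightarrow> ge n y \<Longrightarrow> ge n (x * y)"
  using ge_mult[of 0 x n y] by simp

lemma ge_mult_right: "ge n x \<Longrightarrow> ge 0 y \<Longrightarrow> ge n (x * y)"
  using ge_mult[of n x 0 y] by simp

lemma ge_power: "ge 0 x \<Longrightarrow> ge 0 (x ^ n)"
  by (induction n) (auto intro: ge_mult_left)

lemma ge_sum: "(\<And>a. a \<in> A \<Longrightarrow> ge n (f a)) \<Longrightarrow> ge n (\<Sum>a\<in>A. f a)"
  by (induction A rule: infinite_finite_induct) (auto intro: ge_add)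

lemma ge_of_nat: "ge 0 (of_nat n)"
  by (induction n) (auto intro: ge_add)

lemma ge_all_imp_zero: "(\<And>n::nat. ge (int n) x) \<Longrightarrow> x = 0"
proof (rule ccontr)
  assume ge: "\<And>n::nat. ge (int n) x" and x: "x \<noteq> 0"
  show False using ge[of "nat (v x + 1)"] x by (auto simp: vge_def split: if_splits)
qed

lemma ge_1_multD: "ge 0 x \<Longrightarrow> ge 0 y \<Longrightarrow> ge 1 (x * y) \<Longrightarrow> ge 1 x \<or> ge 1 y"
  by (cases "x = 0"; cases "y = 0") (auto simp: vge_def v_mult)

lemma ge_1_powerD: "ge 1 (x ^ n) \<Longrightarrow> ge 1 x"
proof (cases "x = 0")
  case False
  assume "ge 1 (x ^ n)"
  then have "1 \<le> int n * v x" using False by (simp add: vge_def v_power)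
  then have "0 < v x" by (smt (verit) mult_nonneg_nonpos of_nat_0_le_iff)
  then show ?thesis by (simp add: vge_def)
qed simp

lemma ge_mult_cancel: "x \<noteq> 0 \<Longrightarrow> ge (n + v x) (x * y) \<Longrightarrow> ge n y"
  by (cases "y = 0") (auto simp: vge_def v_mult)

lemma ge_divide: "x \<noteq> 0 \<Longrightarrow> ge n y \<Longrightarrow> ge (n - v x) (y / x)"
  by (cases "y = 0") (auto simp: vge_def v_divide)

lemma cong_mult:
  assumes "ge 0 a" "ge 0 b'" "ge n (a - b)" "ge n (a' - b')"
  shows "ge n (a * a' - b * b')"
proof -
  have "a * a' - b * b' = a * (a' - b') + (a - b) * b'" by (simp add: algebra_simps)
  then show ?thesis using assms by (simp add: ge_add ge_mult_left ge_mult_right)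
qed

lemma cong_power:
  assumes "ge 0 a" "ge 0 b" "ge n (a - b)"
  shows "ge n (a ^ k - b ^ k)"
  using assms by (induction k) (auto intro!: cong_mult ge_power)

lemma cong_prod_1:
  assumes "\<And>a. a \<in> A \<Longrightarrow> ge 1 (f a - 1)"
  shows "ge 1 ((\<Prod>a\<in>A. f a) - 1)"
  using assms
proof (induction A rule: infinite_finite_induct)
  case (insert x F)
  have fx: "ge 1 (f x - 1)" using insert by auto
  have "ge 0 (f x)" using ge_add[OF ge_mono[OF fx, of 0], of 1] by simp
  then have "ge 1 (f x * (\<Prod>a\<in>F. f a) - 1 * 1)"
    using insert fx by (intro cong_mult) auto
  then show ?case using insert by simp
qed auto

text \<open>In \<open>a ^ N - b ^ N = (a - b) * (\<Sum> ...)\<close> the sum is congruent to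
  \<open>N * b ^ (N - 1)\<close> modulo \<open>P\<close>, hence to zero. This gain of one in
  precision drives the convergence to Teichmueller representatives.\<close>

lemma cong_power_raise:
  assumes ab: "ge 0 a" "ge 0 b" "ge n (a - b)" and n: "1 \<le> n" and N: "ge 1 (of_nat N)"
  shows "ge (n + 1) (a ^ N - b ^ N)"
proof -
  have "ge 1 (b ^ (N - Suc i) * a ^ i - b ^ (N - 1))" if "i < N" for i
  proof -
    have "b ^ (N - 1) = b ^ (N - Suc i) * b ^ i"
      using that by (simp flip: power_add)
    moreover have "ge 1 (a ^ i - b ^ i)"
      using ge_mono[OF cong_power[OF ab, of i] n] .
    ultimately show ?thesis
      using ab(2) by (auto simp flip: right_diff_distrib intro!: ge_mult_left ge_power)
  qed
  then have "ge 1 (\<Sum>i<N. b ^ (N - Suc i) * a ^ i - b ^ (N - 1))"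
    by (intro ge_sum) auto
  moreover have "ge 1 (of_nat N * b ^ (N - 1))"
    using N ab(2) by (intro ge_mult_right ge_power)
  ultimately have "ge 1 (\<Sum>i<N. b ^ (N - Suc i) * a ^ i)"
    using ge_add by (fastforce simp: sum_subtractf)
  then show ?thesis
    using ab(3) by (simp add: power_diff_sumr2 ge_mult)
qed

text \<open>Injectivity of Frobenius on the residue field: the middle binomial coefficients are
  divisible by \<open>q\<close>, so \<open>(x - 1) ^ q\<close> is congruent to
  \<open>x ^ q - 1\<close>.\<close>

lemma frobenius_cong_1:
  assumes q: "prime q" "ge 1 (of_nat q)" and x: "ge 0 x" "ge 1 (x ^ q - 1)"
  shows "ge 1 (x - 1)"
proof -
  define y where "y = x - 1"
  have y: "ge 0 y" using x by (simp add: y_def ge_diff)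
  have "x ^ q = (y + 1) ^ q" by (simp add: y_def)
  also have "\<dots> = (\<Sum>k\<le>q. of_nat (q choose k) * y ^ k)" by (simp add: binomial_ring)
  also have "{..q} = insert 0 (insert q {0<..<q})" using prime_gt_0_nat[OF q(1)] by auto
  also have "(\<Sum>k\<in>\<dots>. of_nat (q choose k) * y ^ k) = 1 + y ^ q + (\<Sum>k\<in>{0<..<q}. of_nat (q choose k) * y ^ k)"
    using prime_gt_0_nat[OF q(1)] by simp
  finally have eq: "y ^ q = (x ^ q - 1) - (\<Sum>k\<in>{0<..<q}. of_nat (q choose k) * y ^ k)" by simp
  have "ge 1 (of_nat (q choose k) * y ^ k)" if k: "k \<in> {0<..<q}" for k
  proof -
    have "q dvd (q choose k)"
      using k q(1) by (intro dvd_choose_prime) auto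
    then obtain m where "q choose k = q * m" by auto
    then show ?thesis
      using q(2) y by (auto intro!: ge_mult_right ge_power ge_of_nat)
  qed
  then have "ge 1 (y ^ q)"
    unfolding eq using x(2) by (auto intro!: ge_diff ge_sum)
  then show ?thesis using ge_1_powerD y_def by auto
qed

lemma frobenius_power_cong_1:
  assumes q: "prime q" "ge 1 (of_nat q)" and x: "ge 0 x" "ge 1 (x ^ (q ^ s) - 1)"
  shows "ge 1 (x - 1)"
  using x(2)
proof (induction s)
  case (Suc s)
  have "ge 1 ((x ^ (q ^ s)) ^ q - 1)"
    using Suc.prems by (simp add: power_mult[symmetric] mult.commute)
  then show ?case
    using Suc.IH frobenius_cong_1[OF q ge_power[OF x(1)]] by blast
qed simp

text \<open>Artin's argument, run modulo the maximal ideal.\<close>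
lemma characters_independent:
  assumes "finite I"
    and "\<And>x y. x \<in> U \<Longrightarrow> y \<in> U \<Longrightarrow> x * y \<in> U" "U \<noteq> {}"
    and "\<And>i x. i \<in> I \<Longrightarrow> x \<in> U \<Longrightarrow> ge 0 (\<chi> i x) \<and> \<not> ge 1 (\<chi> i x)"
    and "\<And>i x y. i \<in> I \<Longrightarrow> x \<in> U \<Longrightarrow> y \<in> U \<Longrightarrow> \<chi> i (x * y) = \<chi> i x * \<chi> i y"
    and "\<And>i j. i \<in> I \<Longrightarrow> j \<in> I \<Longrightarrow> i \<noteq> j \<Longrightarrow> \<exists>x\<in>U. \<not> ge 1 (\<chi> i x - \<chi> j x)"
    and "\<And>i. i \<in> I \<Longrightarrow> ge 0 (b i)"
    and "\<And>x. x \<in> U \<Longrightarrow> ge 1 (\<Sum>i\<in>I. b i * \<chi> i x)"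
    and "i \<in> I"
  shows "ge 1 (b i)"
  using assms
proof (induction I arbitrary: b i rule: finite_induct)
  case (insert k F)
  note U = insert.prems(1) and unit = insert.prems(3) and hom = insert.prems(4)
    and dist = insert.prems(5) and b = insert.prems(6) and rel = insert.prems(7)
  have bF: "ge 1 (b j)" if j: "j \<in> F" for j
  proof -
    have "j \<noteq> k" using j insert.hyps by auto
    then obtain u where u: "u \<in> U" "\<not> ge 1 (\<chi> j u - \<chi> k u)"
      using dist[of j k] j by auto
    \<comment> \<open>Subtracting \<open>\<chi> k u\<close> times the relation at \<open>x\<close>
      from the relation at \<open>u * x\<close> removes the term of \<open>k\<close> and leaves
      these coefficients.\<close>
    define b' where "b' i = b i * (\<chi> i u - \<chi> k u)" for i
    have int: "ge 0 (\<chi> i u - \<chi> k u)" if "i \<in> F" for i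
      using that u(1) unit[of i u] unit[of k u] by (auto intro: ge_diff)
    have "ge 1 (b' j)"
    proof (rule insert.IH)
      show "ge 1 (\<Sum>i\<in>F. b' i * \<chi> i x)" if x: "x \<in> U" for x
      proof -
        have "(\<Sum>i\<in>insert k F. b i * \<chi> i (u * x)) - \<chi> k u * (\<Sum>i\<in>insert k F. b i * \<chi> i x)
            = (\<Sum>i\<in>insert k F. b i * (\<chi> i u - \<chi> k u) * \<chi> i x)"
          using hom[OF _ u(1) x]
          by (simp add: sum_distrib_left sum_subtractf[symmetric] algebra_simps)
        also have "\<dots> = (\<Sum>i\<in>F. b' i * \<chi> i x)"
          using insert.hyps by (simp add: b'_def)
        finally have "(\<Sum>i\<in>F. b' i * \<chi> i x) = (\<Sum>i\<in>insert k F. b i * \<chi> i (u * x))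
            - \<chi> k u * (\<Sum>i\<in>insert k F. b i * \<chi> i x)" by simp
        moreover have "ge 1 (\<chi> k u * (\<Sum>i\<in>insert k F. b i * \<chi> i x))"
          using rel[OF x] unit[of k u] u(1) by (intro ge_mult_left) auto
        ultimately show ?thesis
          using rel[OF U[OF u(1) x]] by (auto intro: ge_diff)
      qed
    qed (use insert.prems int j in \<open>auto simp: b'_def intro: ge_mult_left\<close>)
    then show ?thesis
      using ge_1_multD[of "b j" "\<chi> j u - \<chi> k u"] b int u j by (auto simp: b'_def)
  qed
  obtain x where x: "x \<in> U" using insert.prems(2) by auto
  have "(\<Sum>i\<in>insert k F. b i * \<chi> i x) - (\<Sum>i\<in>F. b i * \<chi> i x) = b k * \<chi> k x"
    using insert.hyps by simp
  moreover have "ge 1 (\<Sum>i\<in>F. b i * \<chi> i x)"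
    using bF unit x by (auto intro!: ge_sum ge_mult_right)
  ultimately have "ge 1 (b k * \<chi> k x)"
    using rel[OF x] by (metis ge_diff)
  then have "ge 1 (b k)"
    using ge_1_multD[of "b k" "\<chi> k x"] b unit[of k x] x by auto
  then show ?case using bF insert.prems(8) by auto
qed simp

lemma cauchy_of_steps:
  assumes "\<And>k. ge (int k) (s (Suc k) - s k)"
  shows "cauchy_v v s"
proof -
  have step: "ge (int k) (s (k + d) - s k)" for k d
  proof (induction d)
    case (Suc d)
    have "ge (int k) (s (Suc (k + d)) - s (k + d))"
      using assms[of "k + d"] by (rule ge_mono) simp
    then show ?case using ge_trans Suc by auto
  qed simp
  have "ge n (s i - s j)" if "i \<ge> nat n" "j \<ge> nat n" for n i j
  proof -
    have "ge n (s i - s (nat n))" "ge n (s j - s (nat n))"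
      using step[of "nat n" "i - nat n"] step[of "nat n" "j - nat n"] that
      by (auto intro: ge_mono)
    then show ?thesis using ge_trans ge_minus_commute by blast
  qed
  then show ?thesis unfolding cauchy_v_def by blast
qed

end

section \<open>The base field and the finite residue field\<close>

locale local_extension = discretely_valued v
  for v :: "'a::field \<Rightarrow> int" +
  fixes K :: "'a set" and p :: 'a
  assumes complete: "cauchy_v v s \<Longrightarrow> \<exists>l. converges_v v s l"
    and finite_residue: "\<exists>R. finite R \<and> (\<forall>x\<in>val_ring v. \<exists>r\<in>R. x - r \<in> val_ideal v)"
    and subfield: "is_subfield K"
    and unif: "uniformizer v K p"
begin

lemma K_0: "0 \<in> K" and K_1: "1 \<in> K"
  and K_add: "x \<in> K \<Longrightarrow> y \<in> K \<Longrightarrow> x + y \<in> K"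
  and K_mult: "x \<in> K \<Longrightarrow> y \<in> K \<Longrightarrow> x * y \<in> K"
  and K_uminus: "x \<in> K \<Longrightarrow> - x \<in> K"
  and K_inverse: "x \<in> K \<Longrightarrow> inverse x \<in> K"
  using subfield unfolding is_subfield_def by auto

lemma K_diff: "x \<in> K \<Longrightarrow> y \<in> K \<Longrightarrow> x - y \<in> K"
  using K_add[of x "- y"] K_uminus by simp

lemma K_divide: "x \<in> K \<Longrightarrow> y \<in> K \<Longrightarrow> x / y \<in> K"
  using K_mult[of x "inverse y"] K_inverse by (simp add: divide_inverse)

lemma K_power: "x \<in> K \<Longrightarrow> x ^ n \<in> K"
  by (induction n) (auto intro: K_1 K_mult)

lemma K_sum: "(\<And>a. a \<in> A \<Longrightarrow> f a \<in> K) \<Longrightarrow> (\<Sum>a\<in>A. f a) \<in> K"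
  by (induction A rule: infinite_finite_induct) (auto intro: K_0 K_add)

lemma p_K: "p \<in> K" and p_nz [simp]: "p \<noteq> 0" and v_p: "0 < v p"
  and v_p_le: "y \<in> K \<Longrightarrow> y \<noteq> 0 \<Longrightarrow> 0 < v y \<Longrightarrow> v p \<le> v y"
  using unif unfolding uniformizer_def by auto

text \<open>Since \<open>v\<close> is normalised on \<open>L\<close>, \<open>v p\<close> is the
  ramification index. This is the device that upgrades congruences modulo \<open>P\<close> between
  elements of \<open>K\<close> to congruences modulo \<open>p\<close>.\<close>

lemma K_ge_1_imp: "x \<in> K \<Longrightarrow> ge 1 x \<Longrightarrow> ge (v p) x"
  using v_p_le by (fastforce simp: vge_def)

lemma mem_val_ring [simp]: "x \<in> val_ring v \<longleftrightarrow> ge 0 x"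
  and mem_val_ideal [simp]: "x \<in> val_ideal v \<longleftrightarrow> ge 1 x"
  by (auto simp: val_ring_def val_ideal_def)

lemma residue_reps: "\<exists>R. finite R \<and> (\<forall>r\<in>R. ge 0 r) \<and> (\<forall>x. ge 0 x \<longrightarrow> (\<exists>r\<in>R. ge 1 (x - r)))"
proof -
  obtain R where R: "finite R" "\<And>x. ge 0 x \<Longrightarrow> \<exists>r\<in>R. ge 1 (x - r)"
    using finite_residue by auto
  have "ge 0 r" if "ge 0 x" "ge 1 (x - r)" for x r
    using ge_diff[OF that(1) ge_mono[OF that(2)]] by simp
  then have "\<forall>x. ge 0 x \<longrightarrow> (\<exists>r\<in>{r\<in>R. ge 0 r}. ge 1 (x - r))"
    using R(2) by blast
  then show ?thesis using R(1) by (intro exI[of _ "{r\<in>R. ge 0 r}"]) auto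
qed

lemma residue_pigeonhole:
  assumes "\<And>k::nat. ge 0 (f k)"
  obtains i j where "i < j" "ge 1 (f i - f j)"
proof -
  obtain R where R: "finite R" "\<And>x. ge 0 x \<Longrightarrow> \<exists>r\<in>R. ge 1 (x - r)"
    using residue_reps by meson
  define \<rho> where "\<rho> k = (SOME r. r \<in> R \<and> ge 1 (f k - r))" for k
  have "\<rho> k \<in> R \<and> ge 1 (f k - \<rho> k)" for k
    unfolding \<rho>_def by (rule someI_ex) (use R(2)[OF assms[of k]] in blast)
  then have \<rho>: "\<And>k. \<rho> k \<in> R" "\<And>k. ge 1 (f k - \<rho> k)" by auto
  have "finite (range \<rho>)" using R(1) \<rho>(1) by (auto intro: finite_subset)
  then have "\<not> inj \<rho>" using finite_imageD infinite_UNIV_nat by blast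
  then obtain i j where "i \<noteq> j" "\<rho> i = \<rho> j" by (auto simp: inj_on_def)
  then have "ge 1 (f i - f j)"
    using ge_diff[OF \<rho>(2)[of i] \<rho>(2)[of j]] by simp
  then have "ge 1 (f (min i j) - f (max i j))"
    using ge_minus_commute[of 1 "f i" "f j"] by (simp add: min_def max_def)
  moreover have "min i j < max i j" using \<open>i \<noteq> j\<close> by simp
  ultimately show ?thesis using that by blast
qed

text \<open>Pigeonhole on the integers puts a positive integer into \<open>P\<close>; the least one
  is prime because \<open>P\<close> is a prime ideal.\<close>

lemma residue_characteristic: "\<exists>q. prime q \<and> ge 1 (of_nat q)"
proof -
  obtain i j :: nat where ij: "i < j" "ge 1 (of_nat i - of_nat j)"
    using residue_pigeonhole[of of_nat] ge_of_nat by blast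
  then have "ge 1 (of_nat (j - i))"
    using ge_minus_commute by (simp add: of_nat_diff)
  then have ex: "\<exists>n>0. ge 1 (of_nat n)" using ij(1) by (metis zero_less_diff)
  define q where "q = (LEAST n. 0 < n \<and> ge 1 (of_nat n))"
  have q: "0 < q" "ge 1 (of_nat q)" and least: "\<And>n. 0 < n \<Longrightarrow> ge 1 (of_nat n) \<Longrightarrow> q \<le> n"
    using LeastI_ex[OF ex] Least_le[of "\<lambda>n. 0 < n \<and> ge 1 (of_nat n)"] by (auto simp: q_def)
  have "prime q"
    unfolding prime_nat_iff
  proof (intro conjI allI impI)
    show "1 < q" using q by (cases "q = 1") auto
    fix m assume "m dvd q"
    then obtain k where k: "q = m * k" by auto
    then have "ge 1 (of_nat m) \<or> ge 1 (of_nat k)"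
      using ge_1_multD[OF ge_of_nat ge_of_nat] q(2) by simp
    then have "q \<le> m \<or> q \<le> k" using least[of m] least[of k] k q(1) by auto
    then show "m = 1 \<or> m = q"
    proof
      assume "q \<le> m"
      then have "m = q" using \<open>m dvd q\<close> q(1) dvd_imp_le by fastforce
      then show ?thesis ..
    next
      assume "q \<le> k"
      then have "k = q" using k q(1) dvd_imp_le[of k q] by fastforce
      then show ?thesis using k q(1) by simp
    qed
  qed
  then show ?thesis using q(2) by blast
qed

text \<open>The residue characteristic; the letter \<open>p\<close> belongs to the uniformizer of
  \<open>K\<close>.\<close>

definition q :: nat where "q = (SOME q. prime q \<and> ge 1 (of_nat q))"

lemma prime_q: "prime q" and ge_q: "ge 1 (of_nat q)"
  using someI_ex[OF residue_characteristic] by (auto simp: q_def)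

definition \<pi> :: 'a where "\<pi> = (SOME x. x \<noteq> 0 \<and> v x = 1)"

lemma \<pi>_nz [simp]: "\<pi> \<noteq> 0" and v_\<pi> [simp]: "v \<pi> = 1"
proof -
  have "\<exists>x. x \<noteq> 0 \<and> v x = 1" using dv unfolding discrete_valuation_def by blast
  from someI_ex[OF this] show "\<pi> \<noteq> 0" "v \<pi> = 1" by (auto simp: \<pi>_def)
qed

section \<open>The Galois group and invariance of the valuation\<close>

abbreviation G where "G \<equiv> Gal K"

lemma
  assumes "\<sigma> \<in> G"
  shows G_add: "\<sigma> (x + y) = \<sigma> x + \<sigma> y" and G_mult: "\<sigma> (x * y) = \<sigma> x * \<sigma> y"
    and G_fix: "x \<in> K \<Longrightarrow> \<sigma> x = x" and G_bij: "bij \<sigma>"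
  using assms unfolding Gal_def by auto

lemma G_0: "\<sigma> \<in> G \<Longrightarrow> \<sigma> 0 = 0" and G_1: "\<sigma> \<in> G \<Longrightarrow> \<sigma> 1 = 1"
  using G_fix K_0 K_1 by auto

lemma G_eq_0_iff: "\<sigma> \<in> G \<Longrightarrow> \<sigma> x = 0 \<longleftrightarrow> x = 0"
  using G_bij G_0 by (metis bij_is_inj inj_eq)

lemma G_uminus: "\<sigma> \<in> G \<Longrightarrow> \<sigma> (- x) = - \<sigma> x"
  using G_add[of \<sigma> x "- x"] G_0[of \<sigma>] by (simp add: eq_neg_iff_add_eq_0 add.commute)

lemma G_diff: "\<sigma> \<in> G \<Longrightarrow> \<sigma> (x - y) = \<sigma> x - \<sigma> y"
  using G_add[of \<sigma> x "- y"] G_uminus by simp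

lemma G_power: "\<sigma> \<in> G \<Longrightarrow> \<sigma> (x ^ n) = \<sigma> x ^ n"
  by (induction n) (auto simp: G_1 G_mult)

lemma G_sum: "\<sigma> \<in> G \<Longrightarrow> \<sigma> (\<Sum>a\<in>A. f a) = (\<Sum>a\<in>A. \<sigma> (f a))"
  by (induction A rule: infinite_finite_induct) (auto simp: G_0 G_add)

lemma G_prod: "\<sigma> \<in> G \<Longrightarrow> \<sigma> (\<Prod>a\<in>A. f a) = (\<Prod>a\<in>A. \<sigma> (f a))"
  by (induction A rule: infinite_finite_induct) (auto simp: G_1 G_mult)

lemma G_divide: "\<sigma> \<in> G \<Longrightarrow> \<sigma> (x / y) = \<sigma> x / \<sigma> y"
proof (cases "y = 0")
  case False
  assume \<sigma>: "\<sigma> \<in> G"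
  have "\<sigma> (x / y) * \<sigma> y = \<sigma> x" using G_mult[OF \<sigma>, of "x / y" y] False by simp
  then show ?thesis using False G_eq_0_iff[OF \<sigma>] by (simp add: eq_divide_eq)
qed (simp add: G_0)

lemma G_id: "id \<in> G" unfolding Gal_def by auto

lemma G_comp: "\<sigma> \<in> G \<Longrightarrow> \<tau> \<in> G \<Longrightarrow> \<sigma> \<circ> \<tau> \<in> G"
  unfolding Gal_def by (auto simp: bij_comp)

lemma G_inv: "\<sigma> \<in> G \<Longrightarrow> inv \<sigma> \<in> G"
proof -
  assume \<sigma>: "\<sigma> \<in> G"
  have surj: "\<sigma> (inv \<sigma> x) = x" for x using G_bij[OF \<sigma>] by (simp add: bij_is_surj surj_f_inv_f)
  have inj: "\<sigma> x = \<sigma> y \<Longrightarrow> x = y" for x y using G_bij[OF \<sigma>] by (simp add: bij_is_inj inj_eq)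
  show ?thesis
    unfolding Gal_def
  proof (intro CollectI conjI allI ballI)
    show "bij (inv \<sigma>)" using G_bij[OF \<sigma>] by (rule bij_imp_bij_inv)
    show "inv \<sigma> (x + y) = inv \<sigma> x + inv \<sigma> y" for x y
      by (rule inj) (simp add: G_add[OF \<sigma>] surj)
    show "inv \<sigma> (x * y) = inv \<sigma> x * inv \<sigma> y" for x y
      by (rule inj) (simp add: G_mult[OF \<sigma>] surj)
    show "inv \<sigma> k = k" if "k \<in> K" for k
      by (rule inj) (simp add: G_fix[OF \<sigma> that] surj)
  qed
qed

lemma inv_G [simp]: "\<sigma> \<in> G \<Longrightarrow> inv \<sigma> (\<sigma> x) = x" "\<sigma> \<in> G \<Longrightarrow> \<sigma> (inv \<sigma> x) = x"
  by (simp_all add: G_bij bij_is_inj bij_is_surj surj_f_inv_f)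

lemma inv_comp_G [simp]: "\<sigma> \<in> G \<Longrightarrow> inv \<sigma> \<circ> \<sigma> = id" "\<sigma> \<in> G \<Longrightarrow> \<sigma> \<circ> inv \<sigma> = id"
  by (auto simp: fun_eq_iff)

text \<open>The equation \<open>t ^ n + t = x\<close> has a root for every \<open>n \<ge> 2\<close> when \<open>v x > 0\<close>, whereas
  \<open>v x < 0\<close> would force \<open>n\<close> to divide \<open>v x\<close>. Being preserved by automorphisms, solvability
  shows that \<open>v (\<sigma> x) \<ge> 0\<close>.\<close>

lemma root_power_plus:
  assumes x: "ge 1 x" and n: "2 \<le> n"
  shows "\<exists>t. t ^ n + t = x"
proof -
  \<comment> \<open>Fixed point iteration for \<open>t = x - t ^ n\<close>. It contracts on
    \<open>P\<close> because for \<open>n \<ge> 2\<close> every term of the sum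
    \<open>(a ^ n - b ^ n) / (a - b)\<close> contains a factor from \<open>P\<close>.\<close>
  define s where "s = rec_nat 0 (\<lambda>_ t. x - t ^ n)"
  have s0: "s 0 = 0" and sS: "s (Suc k) = x - s k ^ n" for k by (simp_all add: s_def)
  have pow: "ge 1 (t ^ j)" if "j \<noteq> 0" "ge 1 t" for t j
  proof -
    have "t ^ j = t * t ^ (j - 1)" using that by (cases j) auto
    then show ?thesis
      using that ge_mono[OF that(2), of 0] by (auto intro!: ge_mult_right ge_power)
  qed
  have s1: "ge 1 (s k)" for k
    by (induction k) (use n in \<open>auto simp: s0 sS intro!: ge_diff x pow\<close>)
  have contract: "ge (m + 1) (a ^ n - b ^ n)" if "ge 1 a" "ge 1 b" "ge m (a - b)" for a b m
  proof -
    have int: "ge 0 a" "ge 0 b" using that by (auto intro: ge_mono)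
    have "ge 1 (\<Sum>i<n. b ^ (n - Suc i) * a ^ i)"
    proof (intro ge_sum)
      fix i assume "i \<in> {..<n}"
      then consider "n - Suc i \<noteq> 0" | "i \<noteq> 0" using n by fastforce
      then show "ge 1 (b ^ (n - Suc i) * a ^ i)"
      proof cases
        case 1
        then show ?thesis
          using pow[OF _ that(2)] int(1) by (intro ge_mult_right ge_power) auto
      next
        case 2
        then show ?thesis
          using pow[OF _ that(1)] int(2) by (intro ge_mult_left ge_power) auto
      qed
    qed
    then show ?thesis using that(3) by (simp add: power_diff_sumr2 ge_mult)
  qed
  have step: "ge (int k) (s (Suc k) - s k)" for k
  proof (induction k)
    case 0
    show ?case using s1[of 1] by (auto simp: s0 intro: ge_mono)
  next
    case (Suc k)
    have "s (Suc (Suc k)) - s (Suc k) = s k ^ n - s (Suc k) ^ n" by (simp add: sS)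
    moreover have "ge (int k) (s k - s (Suc k))" using Suc ge_minus_commute by blast
    ultimately show ?case
      using contract[OF s1 s1, of "int k" k "Suc k"] by (simp add: add.commute)
  qed
  then obtain l where l: "converges_v v s l" using complete cauchy_of_steps by blast
  have "l ^ n + l - x = 0"
  proof (rule ge_all_imp_zero)
    fix N :: nat
    obtain M where M: "\<And>i. i \<ge> M \<Longrightarrow> ge (int N + 1) (s i - l)"
      using l unfolding converges_v_def by blast
    have 1: "ge (int N + 1) (s M - l)" "ge (int N + 1) (s (Suc M) - l)" using M by auto
    have "ge 1 (s M - l)" using 1(1) by (rule ge_mono) simp
    then have "ge 1 l" using ge_diff[OF s1[of M], of "s M - l"] by simp
    then have "ge (int N + 1) (s M ^ n - l ^ n)"
      using 1(1) contract[OF s1[of M], of l "int N + 1"] by (auto intro: ge_mono)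
    then have "ge (int N + 1) ((s M ^ n - l ^ n) + (s (Suc M) - l))" using 1(2) by (rule ge_add)
    moreover have "(s M ^ n - l ^ n) + (s (Suc M) - l) = - (l ^ n + l - x)" by (simp add: sS)
    ultimately have "ge (int N + 1) (l ^ n + l - x)" by (simp del: minus_diff_eq)
    then show "ge (int N) (l ^ n + l - x)" by (rule ge_mono) simp
  qed
  then show ?thesis by (intro exI[of _ l]) simp
qed

text \<open>An integral \<open>t\<close> would make \<open>y\<close> integral, so
  \<open>v t < 0\<close> and \<open>t ^ n\<close> strictly dominates \<open>t\<close>.\<close>

lemma v_power_plus_neg:
  assumes "t ^ n + t = y" "y \<noteq> 0" "v y < 0" "2 \<le> n"
  shows "v y = int n * v t"
proof -
  have t: "t \<noteq> 0" using assms by (auto simp: power_0_left)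
  have vt: "v t < 0"
  proof (rule ccontr)
    assume "\<not> v t < 0"
    then have "ge 0 t" by (simp add: vge_def)
    then have "ge 0 (t ^ n + t)" by (intro ge_add ge_power)
    then show False using assms by (simp add: vge_def)
  qed
  then have lt: "int n * v t < v t" using assms(4)
    by (simp add: mult_less_cancel_right2)
  have "ge (int n * v t) (t ^ n + t)"
    using lt t by (intro ge_add) (auto simp: vge_def v_power)
  moreover have "\<not> ge (int n * v t + 1) y"
  proof
    assume "ge (int n * v t + 1) y"
    moreover have "ge (int n * v t + 1) t" using lt by (simp add: vge_def)
    ultimately have "ge (int n * v t + 1) (y - t)" by (rule ge_diff)
    then have "ge (int n * v t + 1) (t ^ n)" using assms(1) by auto
    then show False using t by (simp add: vge_def v_power)
  qed
  ultimately show ?thesis using assms(1,2) by (simp add: vge_def)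
qed

lemma G_ge_0:
  assumes \<sigma>: "\<sigma> \<in> G" and x: "ge 1 x"
  shows "ge 0 (\<sigma> x)"
proof (rule ccontr)
  assume "\<not> ge 0 (\<sigma> x)"
  then have y: "\<sigma> x \<noteq> 0" "v (\<sigma> x) < 0" by (auto simp: vge_def)
  \<comment> \<open>With this choice \<open>v (\<sigma> x) = 1 - n\<close>, which \<open>n\<close>
    does not divide since \<open>n \<ge> 2\<close>.\<close>
  define n where "n = nat (1 - v (\<sigma> x))"
  have n: "int n = 1 - v (\<sigma> x)" "2 \<le> n" using y(2) by (auto simp: n_def)
  obtain t where "t ^ n + t = x" using root_power_plus[OF x n(2)] by blast
  then have "\<sigma> t ^ n + \<sigma> t = \<sigma> x" using G_add[OF \<sigma>, of "t ^ n" t] G_power[OF \<sigma>, of t n] by simp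
  then have "v (\<sigma> x) = int n * v (\<sigma> t)" using v_power_plus_neg y n(2) by blast
  then have "int n * (v (\<sigma> t) + 1) = 1" using n(1) by (simp only: distrib_left mult_1_right)
  then have "int n dvd 1" by (metis dvd_triv_left)
  then show False using n(2) by simp
qed

text \<open>\<open>G_ge_0\<close> only says that \<open>P\<close> is mapped into \<open>O\<close>,
  so it has to be amplified. If \<open>v (\<tau> x) < v x\<close>, the unit \<open>b\<close> built
  from \<open>x\<close> and \<open>p\<close> gets a negative valuation under \<open>\<tau>\<close>,
  and its power with exponent \<open>n = v p + 1\<close> outweighs the extra factor
  \<open>p\<close>. Applying the inequality to \<open>inv \<sigma>\<close> gives equality.\<close>

lemma v_G:
  assumes \<sigma>: "\<sigma> \<in> G"
  shows "v (\<sigma> x) = v x"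
proof -
  define m where "m = nat (v p)"
  have m: "int m = v p" using v_p by (simp add: m_def)
  have le: "v x \<le> v (\<tau> x)" if \<tau>: "\<tau> \<in> G" and x: "x \<noteq> 0" for \<tau> x
  proof -
    have \<tau>x: "\<tau> x \<noteq> 0" using x G_eq_0_iff[OF \<tau>] by simp
    define n where "n = nat (v p) + 1"
    text \<open>The element \<open>(x ^ v p / p ^ v x) ^ n * p\<close> has valuation \<open>v p > 0\<close>.\<close>
    define a where "a = nat \<bar>v x\<bar>"
    define b where "b = (if v x \<ge> 0 then x ^ m / p ^ a else x ^ m * p ^ a)"
    have b: "b \<noteq> 0" using x by (simp add: b_def)
    have vb: "v b = 0" using x m by (simp add: b_def v_divide v_mult v_power a_def)
    have \<tau>b: "\<tau> b \<noteq> 0" using b G_eq_0_iff[OF \<tau>] by simp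
    have "\<tau> b = (if v x \<ge> 0 then \<tau> x ^ m / p ^ a else \<tau> x ^ m * p ^ a)"
      using \<tau> by (simp add: b_def G_divide G_mult G_power G_fix p_K)
    then have v\<tau>b: "v (\<tau> b) = v p * (v (\<tau> x) - v x)"
      using \<tau>x m by (simp add: v_divide v_mult v_power a_def algebra_simps)
    have "ge 1 (b ^ n * p)" using b vb v_p by (simp add: vge_def v_mult v_power)
    then have "ge 0 (\<tau> (b ^ n * p))" using G_ge_0[OF \<tau>] by blast
    moreover have "\<tau> (b ^ n * p) = \<tau> b ^ n * p"
      using \<tau> by (simp add: G_mult G_power G_fix p_K)
    ultimately have "0 \<le> int n * v (\<tau> b) + v p"
      using \<tau>b by (simp add: vge_def v_mult v_power)
    moreover have "int n = v p + 1" using v_p by (simp add: n_def)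
    ultimately have "0 \<le> (v p + 1) * v (\<tau> b) + v p" by simp
    moreover have "(v p + 1) * v (\<tau> b) \<le> (v p + 1) * (-1)" if "v (\<tau> b) < 0"
      using that v_p by (intro mult_left_mono) auto
    ultimately have "0 \<le> v (\<tau> b)" by (cases "v (\<tau> b) < 0") auto
    then show ?thesis using v\<tau>b v_p by (simp add: zero_le_mult_iff)
  qed
  show ?thesis
  proof (cases "x = 0")
    case False
    then have "v x \<le> v (\<sigma> x)" "v (\<sigma> x) \<le> v (inv \<sigma> (\<sigma> x))"
      using le \<sigma> G_inv G_eq_0_iff by blast+
    then show ?thesis using \<sigma> by simp
  qed (simp add: G_0[OF \<sigma>])
qed

lemma ge_G [simp]: "\<sigma> \<in> G \<Longrightarrow> ge n (\<sigma> x) \<longleftrightarrow> ge n x"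
  by (simp add: vge_def v_G G_eq_0_iff)

section \<open>Ramification groups\<close>

abbreviation ram where "ram \<equiv> ram_group v K"

lemma ram_G: "\<sigma> \<in> ram i \<Longrightarrow> \<sigma> \<in> G"
  and ram_ge: "\<sigma> \<in> ram i \<Longrightarrow> ge 0 x \<Longrightarrow> ge (i + 1) (\<sigma> x - x)"
  by (auto simp: ram_group_def)

lemma ramI: "\<sigma> \<in> G \<Longrightarrow> (\<And>x. ge 0 x \<Longrightarrow> ge (i + 1) (\<sigma> x - x)) \<Longrightarrow> \<sigma> \<in> ram i"
  by (auto simp: ram_group_def)

lemma ram_antimono: "i \<le> j \<Longrightarrow> ram j \<subseteq> ram i"
  by (auto simp: ram_group_def intro: ge_mono)

definition is_subgroup :: "('a \<Rightarrow> 'a) set \<Rightarrow> bool" where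
  "is_subgroup H \<longleftrightarrow> H \<subseteq> G \<and> id \<in> H \<and> (\<forall>\<sigma>\<in>H. \<forall>\<tau>\<in>H. \<sigma> \<circ> \<tau> \<in> H) \<and> (\<forall>\<sigma>\<in>H. inv \<sigma> \<in> H)"

lemma subgroup_G: "is_subgroup G"
  by (auto simp: is_subgroup_def G_id G_comp G_inv)

lemma subgroup_ram: "is_subgroup (ram i)"
  unfolding is_subgroup_def
proof (intro conjI ballI)
  show "ram i \<subseteq> G" using ram_G by blast
  show "id \<in> ram i" by (rule ramI) (auto simp: G_id)
next
  fix \<sigma> \<tau> assume \<sigma>: "\<sigma> \<in> ram i" and \<tau>: "\<tau> \<in> ram i"
  show "\<sigma> \<circ> \<tau> \<in> ram i"
  proof (rule ramI)
    show "\<sigma> \<circ> \<tau> \<in> G" using \<sigma> \<tau> ram_G G_comp by blast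
    fix x assume "ge 0 x"
    then have "ge (i + 1) (\<sigma> (\<tau> x) - \<tau> x)" "ge (i + 1) (\<tau> x - x)"
      using ram_ge[OF \<sigma>, of "\<tau> x"] ram_ge[OF \<tau>] ram_G[OF \<tau>] by auto
    then show "ge (i + 1) ((\<sigma> \<circ> \<tau>) x - x)" using ge_trans by auto
  qed
next
  fix \<sigma> assume \<sigma>: "\<sigma> \<in> ram i"
  note \<sigma>G = ram_G[OF \<sigma>]
  show "inv \<sigma> \<in> ram i"
  proof (rule ramI)
    show "inv \<sigma> \<in> G" using \<sigma>G by (rule G_inv)
    fix x assume "ge 0 x"
    then have "ge (i + 1) (\<sigma> (inv \<sigma> x) - inv \<sigma> x)"
      using \<sigma>G G_inv[OF \<sigma>G] by (intro ram_ge[OF \<sigma>]) auto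
    then show "ge (i + 1) (inv \<sigma> x - x)" using \<sigma>G ge_minus_commute by auto
  qed
qed

lemma ram_conj:
  assumes \<sigma>: "\<sigma> \<in> G" and h: "h \<in> ram i"
  shows "\<sigma> \<circ> h \<circ> inv \<sigma> \<in> ram i"
proof (rule ramI)
  show "\<sigma> \<circ> h \<circ> inv \<sigma> \<in> G" using \<sigma> ram_G[OF h] by (intro G_comp G_inv)
  fix x assume x: "ge 0 x"
  have "ge (i + 1) (h (inv \<sigma> x) - inv \<sigma> x)"
    using x G_inv[OF \<sigma>] by (intro ram_ge[OF h]) auto
  then have "ge (i + 1) (\<sigma> (h (inv \<sigma> x) - inv \<sigma> x))" using \<sigma> by simp
  then show "ge (i + 1) ((\<sigma> \<circ> h \<circ> inv \<sigma>) x - x)" using \<sigma> by (simp add: G_diff)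
qed

subsection \<open>Teichmueller representatives and expansions\<close>

text \<open>By pigeonhole two Frobenius iterates of \<open>x\<close> agree modulo \<open>P\<close>.
  Their quotient is \<open>y ^ (q ^ i)\<close> with \<open>y = x ^ (q ^ d) / x\<close>, and
  injectivity of Frobenius strips off the exponent \<open>q ^ i\<close>.\<close>

lemma power_q_cong:
  assumes x: "ge 0 x" "\<not> ge 1 x"
  obtains d where "0 < d" "ge 1 (x ^ (q ^ d) - x)"
proof -
  have xnz: "x \<noteq> 0" and vx: "v x = 0" using x by (auto simp: vge_def)
  obtain i j where ij: "i < j" "ge 1 (x ^ (q ^ i) - x ^ (q ^ j))"
    using residue_pigeonhole[of "\<lambda>i. x ^ (q ^ i)"] ge_power[OF x(1)] by blast
  define d where "d = j - i"
  define y where "y = x ^ (q ^ d) / x"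
  have y: "ge 0 y" using xnz vx by (simp add: y_def vge_def v_divide v_power)
  have "j = d + i" using ij(1) by (simp add: d_def)
  then have "x ^ (q ^ j) = (y * x) ^ (q ^ i)"
    using xnz by (simp add: y_def power_add power_mult)
  then have "x ^ (q ^ j) - x ^ (q ^ i) = x ^ (q ^ i) * (y ^ (q ^ i) - 1)"
    by (simp add: algebra_simps power_mult_distrib)
  moreover have "ge 1 (x ^ (q ^ j) - x ^ (q ^ i))" using ij(2) ge_minus_commute by blast
  moreover have "\<not> ge 1 (x ^ (q ^ i))" using x(2) ge_1_powerD by blast
  ultimately have "ge 1 (y ^ (q ^ i) - 1)"
    using ge_1_multD[of "x ^ (q ^ i)" "y ^ (q ^ i) - 1"] x(1) y
    by (auto simp: ge_diff ge_power)
  then have "ge 1 (y - 1)" using frobenius_power_cong_1[OF prime_q ge_q y] by blast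
  then have "ge 1 (x * (y - 1))" using x(1) ge_mult_left by blast
  then have "ge 1 (x ^ (q ^ d) - x)" using xnz by (simp add: y_def algebra_simps)
  moreover have "0 < d" using ij(1) by (simp add: d_def)
  ultimately show ?thesis using that by blast
qed

text \<open>For a unit, \<open>\<omega>\<close> is the limit of \<open>x ^ (Q ^ k)\<close>, where
  \<open>x ^ Q\<close> is congruent to \<open>x\<close>. Inertia fixes this limit:
  \<open>\<sigma> x\<close> and \<open>x\<close> agree modulo \<open>P\<close>, and every further
  power with exponent \<open>Q\<close> improves the agreement by one.\<close>

lemma teichmueller:
  assumes x: "ge 0 x"
  obtains \<omega> where "ge 0 \<omega>" "ge 1 (x - \<omega>)" "\<And>\<sigma>. \<sigma> \<in> ram 0 \<Longrightarrow> \<sigma> \<omega> = \<omega>"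
proof (cases "ge 1 x")
  case True
  show ?thesis using that[of 0] True G_0[OF ram_G] by simp
next
  case False
  obtain d where d: "0 < d" "ge 1 (x ^ (q ^ d) - x)" using power_q_cong[OF x False] .
  define Q where "Q = q ^ d"
  have "of_nat Q = (of_nat q :: 'a) * of_nat (q ^ (d - 1))"
    using d(1) unfolding Q_def by (cases d) auto
  then have geQ: "ge 1 (of_nat Q)" using ge_q ge_of_nat[of "q ^ (d - 1)"] by (simp add: ge_mult_right)
  define s where "s k = x ^ (Q ^ k)" for k
  have s: "ge 0 (s k)" for k using x by (simp add: s_def ge_power)
  have sS: "s (Suc k) = s k ^ Q" for k by (simp add: s_def power_mult[symmetric] mult.commute)
  have step1: "ge (int k + 1) (s (Suc k) - s k)" for k
  proof (induction k)
    case 0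
    show ?case using d(2) by (simp add: s_def Q_def)
  next
    case (Suc k)
    have "ge ((int k + 1) + 1) (s (Suc k) ^ Q - s k ^ Q)"
      using Suc by (intro cong_power_raise s geQ) auto
    then show ?case by (simp add: sS add.commute)
  qed
  then have "cauchy_v v s" by (intro cauchy_of_steps) (rule ge_mono, auto)
  then obtain \<omega> where l: "converges_v v s \<omega>" using complete by blast
  have close: "ge 1 (s k - x)" for k
  proof (induction k)
    case 0
    show ?case by (simp add: s_def)
  next
    case (Suc k)
    have "ge 1 (s (Suc k) - s k)" using step1[of k] by (rule ge_mono) simp
    then show ?case using Suc ge_trans by blast
  qed
  have lim: "\<exists>M. \<forall>k\<ge>M. ge n (s k - \<omega>)" for n using l unfolding converges_v_def by blast
  show ?thesis
  proof (rule that)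
    obtain M where "ge 1 (s M - \<omega>)" using lim[of 1] by auto
    then have "ge 1 (\<omega> - s M)" using ge_minus_commute by blast
    then have "ge 1 (\<omega> - x)" using ge_trans close by blast
    then show 1: "ge 1 (x - \<omega>)" using ge_minus_commute by blast
    show "ge 0 \<omega>" using ge_diff[OF x ge_mono[OF 1]] by simp
  next
    fix \<sigma> assume \<sigma>: "\<sigma> \<in> ram 0"
    have \<sigma>G: "\<sigma> \<in> G" using \<sigma> ram_G by blast
    have \<sigma>s: "ge (int k + 1) (\<sigma> (s k) - s k)" for k
    proof (induction k)
      case 0
      show ?case using ram_ge[OF \<sigma> s[of 0]] by simp
    next
      case (Suc k)
      have "ge ((int k + 1) + 1) (\<sigma> (s k) ^ Q - s k ^ Q)"
        using Suc \<sigma>G s by (intro cong_power_raise geQ) auto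
      then show ?case using \<sigma>G by (simp add: sS add.commute G_power)
    qed
    have "\<sigma> \<omega> - \<omega> = 0"
    proof (rule ge_all_imp_zero)
      fix n :: nat
      obtain M where M: "\<And>k. k \<ge> M \<Longrightarrow> ge (int n) (s k - \<omega>)" using lim[of "int n"] by blast
      define k where "k = max M n"
      have 1: "ge (int n) (s k - \<omega>)" using M by (simp add: k_def)
      have 2: "ge (int n) (\<sigma> \<omega> - \<sigma> (s k))"
        using 1 \<sigma>G ge_minus_commute by (metis G_diff ge_G)
      have 3: "ge (int n) (\<sigma> (s k) - s k)" using \<sigma>s[of k] by (rule ge_mono) (simp add: k_def)
      show "ge (int n) (\<sigma> \<omega> - \<omega>)" using ge_trans[OF 2 ge_trans[OF 3 1]] .
    qed
    then show "\<sigma> \<omega> = \<omega>" by simp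
  qed
qed

text \<open>With \<open>w\<close> of valuation \<open>m > 0\<close> fixed by \<open>S\<close>, the elements \<open>w ^ a * \<pi> ^ b\<close> with \<open>b < m\<close>
  have all nonnegative valuations, so that \<open>m\<close> powers of \<open>\<pi>\<close> suffice.\<close>

lemma expansion:
  assumes S: "S \<subseteq> ram 0" and w: "w \<noteq> 0" "v w = int m" "0 < m" "\<forall>\<sigma>\<in>S. \<sigma> w = w"
    and x: "ge 0 x"
  shows "\<exists>c. (\<forall>i<m. ge 0 (c i) \<and> (\<forall>\<sigma>\<in>S. \<sigma> (c i) = c i)) \<and> ge (int M) (x - (\<Sum>i<m. c i * \<pi> ^ i))"
proof (induction M)
  case 0
  show ?case using x S ram_G G_0 by (intro exI[of _ "\<lambda>_. 0"]) auto
next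
  case (Suc M)
  then obtain c where c: "\<And>i. i < m \<Longrightarrow> ge 0 (c i)" "\<And>i \<sigma>. i < m \<Longrightarrow> \<sigma> \<in> S \<Longrightarrow> \<sigma> (c i) = c i"
    and r: "ge (int M) (x - (\<Sum>i<m. c i * \<pi> ^ i))" by blast
  \<comment> \<open>The remainder has valuation at least \<open>M\<close>. It is corrected by one
    Teichmueller digit times \<open>u\<close>, an element of valuation exactly \<open>M\<close>, and
    only the coefficient of \<open>\<pi> ^ b\<close> changes.\<close>
  define a b where "a = M div m" and "b = M mod m"
  have M: "M = a * m + b" and b: "b < m" using w(3) by (auto simp: a_def b_def)
  define u where "u = w ^ a * \<pi> ^ b"
  have u: "u \<noteq> 0" "v u = int M" using w by (auto simp: u_def v_mult v_power M)
  define r where "r = x - (\<Sum>i<m. c i * \<pi> ^ i)"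
  have "ge 0 (r / u)" using ge_divide[OF u(1), of "int M" r] r u(2) by (simp add: r_def)
  then obtain \<omega> where \<omega>: "ge 0 \<omega>" "ge 1 (r / u - \<omega>)" "\<And>\<sigma>. \<sigma> \<in> ram 0 \<Longrightarrow> \<sigma> \<omega> = \<omega>"
    using teichmueller by blast
  define c' where "c' = c(b := c b + \<omega> * w ^ a)"
  have "(\<Sum>i<m. c' i * \<pi> ^ i) = (\<Sum>i<m. c i * \<pi> ^ i + (if i = b then \<omega> * u else 0))"
    by (intro sum.cong) (auto simp: c'_def u_def algebra_simps)
  also have "\<dots> = (\<Sum>i<m. c i * \<pi> ^ i) + \<omega> * u"
    using b by (simp add: sum.distrib)
  finally have "x - (\<Sum>i<m. c' i * \<pi> ^ i) = u * (r / u - \<omega>)"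
    using u by (simp add: r_def field_simps)
  moreover have "ge (int M + 1) (u * (r / u - \<omega>))"
    using \<omega>(2) u by (intro ge_mult) (auto simp: vge_def)
  moreover have "\<sigma> (c b + \<omega> * w ^ a) = c b + \<omega> * w ^ a" if "\<sigma> \<in> S" for \<sigma>
  proof -
    have "\<sigma> \<in> ram 0" using that S by blast
    then show ?thesis
      using c(2)[OF b that] \<omega>(3) bspec[OF w(4) that] ram_G by (simp add: G_add G_mult G_power)
  qed
  moreover have "ge 0 (w ^ a)" using w by (intro ge_power) (auto simp: vge_def)
  ultimately show ?case
    using c \<omega>
    by (intro exI[of _ c'])
       (auto simp: c'_def add.commute intro!: ge_add ge_mult_left)
qed

text \<open>By the expansion with \<open>w = p\<close>, up to precision \<open>n\<close> every
  integral \<open>x\<close> is a polynomial in \<open>\<pi>\<close> with integral coefficients fixed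
  by \<open>\<sigma>\<close>, so only the differences \<open>\<sigma> \<pi> ^ i - \<pi> ^ i\<close>
  matter.\<close>

lemma ram_0_cong_uniformizer:
  assumes \<sigma>: "\<sigma> \<in> ram 0" and n: "ge n (\<sigma> \<pi> - \<pi>)" and x: "ge 0 x"
  shows "ge n (\<sigma> x - x)"
proof -
  have \<sigma>G: "\<sigma> \<in> G" using \<sigma> ram_G by blast
  define e where "e = nat (v p)"
  define M where "M = nat n"
  have "\<exists>c. (\<forall>i<e. ge 0 (c i) \<and> (\<forall>\<sigma>\<in>{\<sigma>}. \<sigma> (c i) = c i)) \<and> ge (int M) (x - (\<Sum>i<e. c i * \<pi> ^ i))"
    using \<sigma> \<sigma>G v_p x by (intro expansion[of _ p]) (auto simp: e_def G_fix p_K)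
  then obtain c where c: "\<And>i. i < e \<Longrightarrow> ge 0 (c i)" "\<And>i. i < e \<Longrightarrow> \<sigma> (c i) = c i"
    and r: "ge (int M) (x - (\<Sum>i<e. c i * \<pi> ^ i))" by auto
  define y where "y = (\<Sum>i<e. c i * \<pi> ^ i)"
  have r: "ge n (x - y)" using r unfolding y_def by (rule ge_mono) (simp add: M_def)
  have "\<sigma> y - y = (\<Sum>i<e. c i * (\<sigma> \<pi> ^ i - \<pi> ^ i))"
    using c(2) \<sigma>G by (simp add: y_def G_sum G_mult G_power sum_subtractf[symmetric] algebra_simps)
  moreover have \<pi>: "ge 0 \<pi>" by (simp add: vge_def)
  ultimately have y: "ge n (\<sigma> y - y)"
    using c(1) n \<sigma>G by (auto intro!: ge_sum ge_mult_left cong_power)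
  have "ge n (\<sigma> x - \<sigma> y)" using r \<sigma>G by (simp flip: G_diff)
  then show ?thesis using ge_trans[OF _ ge_trans[OF y]] r ge_minus_commute by blast
qed

lemma ram_iff_uniformizer:
  assumes "\<sigma> \<in> ram 0"
  shows "\<sigma> \<in> ram i \<longleftrightarrow> ge (i + 1) (\<sigma> \<pi> - \<pi>)"
proof
  assume "\<sigma> \<in> ram i"
  then show "ge (i + 1) (\<sigma> \<pi> - \<pi>)" by (rule ram_ge) (simp add: vge_def)
next
  assume "ge (i + 1) (\<sigma> \<pi> - \<pi>)"
  then show "\<sigma> \<in> ram i"
    using ram_0_cong_uniformizer[OF assms] ram_G[OF assms] by (intro ramI)
qed

lemma ram_0_fix_uniformizer:
  assumes \<sigma>: "\<sigma> \<in> ram 0" and eq: "\<sigma> \<pi> = \<pi>"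
  shows "\<sigma> = id"
proof
  fix x
  have int: "\<sigma> y = y" if "ge 0 y" for y
  proof -
    have "\<sigma> y - y = 0"
      using ram_0_cong_uniformizer[OF \<sigma> _ that] eq by (intro ge_all_imp_zero) auto
    then show ?thesis by simp
  qed
  show "\<sigma> x = id x"
  proof (cases "ge 0 x")
    case False
    then have "ge 0 (inverse x)" by (auto simp: vge_def v_inverse)
    then have "\<sigma> (1 / x) = 1 / x" using int by (simp add: divide_inverse)
    then have "1 / \<sigma> x = 1 / x" using ram_G[OF \<sigma>] by (simp add: G_divide G_1)
    then show ?thesis by simp
  qed (simp add: int)
qed

text \<open>This makes the conjugates \<open>\<sigma> \<pi>\<close> admissible nodes for
  \<open>lagrange_power_sum\<close>.\<close>

lemma ram_0_inj: "inj_on (\<lambda>\<sigma>. \<sigma> \<pi>) (ram 0)"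
proof (rule inj_onI)
  fix \<sigma> \<tau> assume \<sigma>: "\<sigma> \<in> ram 0" and \<tau>: "\<tau> \<in> ram 0" and eq: "\<sigma> \<pi> = \<tau> \<pi>"
  have "inv \<tau> \<circ> \<sigma> \<in> ram 0" using subgroup_ram[of 0] \<sigma> \<tau> by (auto simp: is_subgroup_def)
  moreover have "(inv \<tau> \<circ> \<sigma>) \<pi> = \<pi>" using eq ram_G[OF \<tau>] by simp
  ultimately have "inv \<tau> \<circ> \<sigma> = id" by (rule ram_0_fix_uniformizer)
  then have "\<tau> \<circ> (inv \<tau> \<circ> \<sigma>) = \<tau>" by simp
  then show "\<sigma> = \<tau>" using ram_G[OF \<tau>] by (simp add: comp_assoc[symmetric])
qed

subsection \<open>Orders and traces\<close>

text \<open>To any precision, the powers of \<open>\<pi>\<close> with exponent below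
  \<open>v w\<close> span \<open>O\<close> over elements fixed by \<open>S\<close>. The functional
  sending \<open>x\<close> to the sum of \<open>D \<sigma> * \<sigma> x\<close> is linear over such
  elements, kills the powers with exponent below \<open>card S - 1\<close> and is 1 on the next one,
  so \<open>v w < card S\<close> is absurd. Taking \<open>S\<close> to be any finite subset allows
  the bound to prove that inertia is finite.\<close>

lemma card_le_v_fixed:
  assumes S: "finite S" "S \<subseteq> ram 0" and w: "w \<noteq> 0" "0 < v w" "\<forall>\<sigma>\<in>S. \<sigma> w = w"
  shows "int (card S) \<le> v w"
proof (rule ccontr)
  assume less: "\<not> int (card S) \<le> v w"
  define m where "m = nat (v w)"
  have m: "v w = int m" "0 < m" using w by (auto simp: m_def)
  have mS: "m < card S" using less m by simp
  have inj: "inj_on (\<lambda>\<sigma>. \<sigma> \<pi>) S" using ram_0_inj S(2) by (rule inj_on_subset)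
  define D where "D \<sigma> = 1 / (\<Prod>\<tau>\<in>S - {\<sigma>}. \<sigma> \<pi> - \<tau> \<pi>)" for \<sigma>
  have lag: "(\<Sum>\<sigma>\<in>S. D \<sigma> * \<sigma> \<pi> ^ i) = (if Suc i = card S then 1 else 0)" if "i < card S" for i
    using lagrange_power_sum[OF S(1) inj that] by (simp add: D_def)
  \<comment> \<open>Enough precision to absorb every denominator \<open>D \<sigma>\<close> and still
    leave valuation at least one.\<close>
  define M where "M = nat (1 + (\<Sum>\<sigma>\<in>S. \<bar>v (D \<sigma>)\<bar>))"
  have D: "ge (1 - int M) (D \<sigma>)" if "\<sigma> \<in> S" for \<sigma>
  proof -
    have "\<bar>v (D \<sigma>)\<bar> \<le> (\<Sum>\<sigma>\<in>S. \<bar>v (D \<sigma>)\<bar>)" using that S(1) by (intro member_le_sum) auto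
    then show ?thesis by (auto simp: M_def vge_def)
  qed
  define x where "x = \<pi> ^ (card S - 1)"
  have x: "ge 0 x" by (simp add: x_def vge_def v_power)
  obtain c where c: "\<And>i \<sigma>. i < m \<Longrightarrow> \<sigma> \<in> S \<Longrightarrow> \<sigma> (c i) = c i"
    and r: "ge (int M) (x - (\<Sum>i<m. c i * \<pi> ^ i))"
    using expansion[where w = w and M = M, OF S(2) w(1) m w(3) x] by blast
  define y where "y = (\<Sum>i<m. c i * \<pi> ^ i)"
  have "(\<Sum>\<sigma>\<in>S. D \<sigma> * \<sigma> y) = (\<Sum>\<sigma>\<in>S. \<Sum>i<m. c i * (D \<sigma> * \<sigma> \<pi> ^ i))"
    unfolding y_def
  proof (intro sum.cong refl)
    fix \<sigma> assume \<sigma>: "\<sigma> \<in> S"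
    then have "\<sigma> \<in> G" using S(2) ram_G by blast
    then show "D \<sigma> * \<sigma> (\<Sum>i<m. c i * \<pi> ^ i) = (\<Sum>i<m. c i * (D \<sigma> * \<sigma> \<pi> ^ i))"
      using c[OF _ \<sigma>] by (simp add: G_sum G_mult G_power sum_distrib_left mult_ac)
  qed
  also have "\<dots> = (\<Sum>i<m. c i * (\<Sum>\<sigma>\<in>S. D \<sigma> * \<sigma> \<pi> ^ i))"
    by (subst sum.swap) (simp add: sum_distrib_left)
  also have "\<dots> = 0" using mS by (intro sum.neutral) (auto simp: lag)
  finally have "(\<Sum>\<sigma>\<in>S. D \<sigma> * \<sigma> y) = 0" .
  moreover have "(\<Sum>\<sigma>\<in>S. D \<sigma> * \<sigma> x) = (\<Sum>\<sigma>\<in>S. D \<sigma> * \<sigma> \<pi> ^ (card S - 1))"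
    using S(2) ram_G by (intro sum.cong) (auto simp: x_def G_power)
  then have "(\<Sum>\<sigma>\<in>S. D \<sigma> * \<sigma> x) = 1" using mS by (simp add: lag)
  moreover have "(\<Sum>\<sigma>\<in>S. D \<sigma> * \<sigma> (x - y)) = (\<Sum>\<sigma>\<in>S. D \<sigma> * \<sigma> x) - (\<Sum>\<sigma>\<in>S. D \<sigma> * \<sigma> y)"
    unfolding sum_subtractf[symmetric] using S(2) ram_G by (intro sum.cong) (auto simp: G_diff right_diff_distrib)
  moreover have "ge 1 (\<Sum>\<sigma>\<in>S. D \<sigma> * \<sigma> (x - y))"
  proof (rule ge_sum)
    fix \<sigma> assume \<sigma>: "\<sigma> \<in> S"
    then have "\<sigma> \<in> G" using S(2) ram_G by blast
    then have "ge (int M) (\<sigma> (x - y))" using r by (simp add: y_def)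
    then show "ge 1 (D \<sigma> * \<sigma> (x - y))" using ge_mult[OF D[OF \<sigma>]] by fastforce
  qed
  ultimately show False by simp
qed

lemma finite_ram_0: "finite (ram 0)"
proof -
  have "finite (ram 0) \<and> card (ram 0) \<le> nat (v p)"
  proof (rule finite_if_finite_subsets_card_bdd)
    fix S assume S: "S \<subseteq> ram 0" "finite S"
    have "\<forall>\<sigma>\<in>S. \<sigma> p = p" using S(1) ram_G G_fix p_K by blast
    then have "int (card S) \<le> v p"
      using S v_p by (intro card_le_v_fixed) auto
    then show "card S \<le> nat (v p)" by simp
  qed
  then show ?thesis ..
qed

text \<open>Automorphisms with the same recorded action on the residue representatives differ by an
  element of the finite group \<open>ram 0\<close>, and there are finitely many such
  actions.\<close>

lemma finite_G: "finite G"
proof -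
  obtain R where R: "finite R" "\<And>r. r \<in> R \<Longrightarrow> ge 0 r" "\<And>x. ge 0 x \<Longrightarrow> \<exists>r\<in>R. ge 1 (x - r)"
    using residue_reps by blast
  define \<phi> where "\<phi> \<sigma> = (\<lambda>r\<in>R. SOME s. s \<in> R \<and> ge 1 (\<sigma> r - s))" for \<sigma> :: "'a \<Rightarrow> 'a"
  have \<phi>: "\<phi> \<sigma> r \<in> R \<and> ge 1 (\<sigma> r - \<phi> \<sigma> r)" if "\<sigma> \<in> G" "r \<in> R" for \<sigma> r
  proof -
    have "\<exists>s. s \<in> R \<and> ge 1 (\<sigma> r - s)" using R(3)[of "\<sigma> r"] R(2) that by auto
    from someI_ex[OF this] show ?thesis using that by (simp add: \<phi>_def)
  qed
  have "\<phi> ` G \<subseteq> R \<rightarrow>\<^sub>E R" using \<phi> by (auto simp: \<phi>_def)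
  then have fin: "finite (\<phi> ` G)" using R(1) finite_PiE by (metis finite_subset)
  have "finite {\<sigma>\<in>G. \<phi> \<sigma> = f}" for f
  proof (cases "\<exists>\<tau>\<in>G. \<phi> \<tau> = f")
    case True
    then obtain \<tau> where \<tau>: "\<tau> \<in> G" "\<phi> \<tau> = f" by blast
    have "\<sigma> \<in> (\<lambda>g. \<tau> \<circ> g) ` ram 0" if \<sigma>: "\<sigma> \<in> G" "\<phi> \<sigma> = f" for \<sigma>
    proof (rule image_eqI)
      show "\<sigma> = \<tau> \<circ> (inv \<tau> \<circ> \<sigma>)" using \<tau> by (simp add: comp_assoc[symmetric])
      show "inv \<tau> \<circ> \<sigma> \<in> ram 0"
      proof (rule ramI)
        show "inv \<tau> \<circ> \<sigma> \<in> G" using \<tau> \<sigma> by (intro G_comp G_inv)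
        fix x assume "ge 0 x"
        then obtain r where r: "r \<in> R" "ge 1 (x - r)" using R(3) by blast
        have 1: "ge 1 (\<sigma> r - f r)" "ge 1 (\<tau> r - f r)"
          using \<phi>[OF \<sigma>(1) r(1)] \<phi>[OF \<tau>(1) r(1)] \<sigma> \<tau> by auto
        have 2: "ge 1 (\<sigma> r - \<tau> r)" using ge_diff[OF 1] by simp
        have 3: "ge 1 (\<sigma> x - \<sigma> r)" "ge 1 (\<tau> x - \<tau> r)"
          using r(2) \<sigma>(1) \<tau>(1) by (simp_all flip: G_diff)
        have "ge 1 (\<sigma> x - \<tau> x)"
          using ge_diff[OF ge_trans[OF 3(1) 2] 3(2)] by simp
        then have "ge 1 (inv \<tau> (\<sigma> x - \<tau> x))" using G_inv[OF \<tau>(1)] by simp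
        then show "ge (0 + 1) ((inv \<tau> \<circ> \<sigma>) x - x)"
          using G_inv[OF \<tau>(1)] \<tau>(1) by (simp add: G_diff)
      qed
    qed
    then have "{\<sigma>\<in>G. \<phi> \<sigma> = f} \<subseteq> (\<lambda>g. \<tau> \<circ> g) ` ram 0" by blast
    then show ?thesis using finite_ram_0 finite_subset by blast
  qed (auto intro: finite_subset[of _ "{}"])
  moreover have "G = (\<Union>f\<in>\<phi> ` G. {\<sigma>\<in>G. \<phi> \<sigma> = f})" by auto
  ultimately show ?thesis using fin by (metis (no_types, lifting) finite_UN)
qed

section \<open>Coset transversals and relative traces\<close>

lemma subgroupD:
  assumes "is_subgroup H"
  shows "H \<subseteq> G" "id \<in> H" "\<And>\<sigma> \<tau>. \<sigma> \<in> H \<Longrightarrow> \<tau> \<in> H \<Longrightarrow> \<sigma> \<circ> \<tau> \<in> H" "\<And>\<sigma>. \<sigma> \<in> H \<Longrightarrow> inv \<sigma> \<in> H" "finite H"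
  using assms finite_G finite_subset by (auto simp: is_subgroup_def)

lemma transversal_exists:
  assumes H: "is_subgroup H" and B: "is_subgroup B" and HB: "H \<subseteq> B"
  obtains R where "R \<subseteq> B" "bij_betw (\<lambda>(r, h). r \<circ> h) (R \<times> H) B"
proof -
  define C where "C \<sigma> = (\<lambda>h. \<sigma> \<circ> h) ` H" for \<sigma> :: "'a \<Rightarrow> 'a"
  \<comment> \<open>The choice is made from the coset as a set, so \<open>rep\<close> takes the same
    value on all its elements.\<close>
  define rep where "rep \<sigma> = (SOME \<tau>. \<tau> \<in> C \<sigma>)" for \<sigma>
  have self: "\<sigma> \<in> C \<sigma>" for \<sigma>
    unfolding C_def using subgroupD(2)[OF H] by (intro image_eqI[of _ _ id]) auto
  have rep: "rep \<sigma> \<in> C \<sigma>" for \<sigma> unfolding rep_def by (rule someI[of "\<lambda>\<tau>. \<tau> \<in> C \<sigma>", OF self])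
  have CC: "C (\<sigma> \<circ> h) = C \<sigma>" if h: "h \<in> H" for \<sigma> h
  proof -
    have hG: "h \<in> G" using subgroupD(1)[OF H] h by blast
    have "\<sigma> \<circ> k \<in> C (\<sigma> \<circ> h)" if "k \<in> H" for k
      unfolding C_def
    proof (rule image_eqI)
      have "(\<sigma> \<circ> h) \<circ> (inv h \<circ> k) = \<sigma> \<circ> (h \<circ> inv h) \<circ> k" by (simp add: comp_assoc)
      then show "\<sigma> \<circ> k = (\<sigma> \<circ> h) \<circ> (inv h \<circ> k)" using hG by simp
      show "inv h \<circ> k \<in> H" using h that subgroupD(3,4)[OF H] by blast
    qed
    moreover have "(\<sigma> \<circ> h) \<circ> k \<in> C \<sigma>" if "k \<in> H" for k
      unfolding C_def comp_assoc using h that subgroupD(3)[OF H] by blast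
    ultimately show ?thesis unfolding C_def by blast
  qed
  have rep_rep: "rep (rep \<sigma> \<circ> h) = rep \<sigma>" if h: "h \<in> H" for \<sigma> h
  proof -
    obtain k where "k \<in> H" "rep \<sigma> = \<sigma> \<circ> k" using rep[of \<sigma>] unfolding C_def by blast
    then have "C (rep \<sigma>) = C \<sigma>" using CC by metis
    then have "C (rep \<sigma> \<circ> h) = C \<sigma>" using CC[OF h] by simp
    then show ?thesis by (simp add: rep_def)
  qed
  have repB: "rep \<sigma> \<in> B" if "\<sigma> \<in> B" for \<sigma>
  proof -
    obtain k where k: "k \<in> H" "rep \<sigma> = \<sigma> \<circ> k" using rep[of \<sigma>] unfolding C_def by blast
    then have "k \<in> B" using HB by blast
    then show ?thesis using subgroupD(3)[OF B that] k(2) by simp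
  qed
  have "bij_betw (\<lambda>(r, h). r \<circ> h) (rep ` B \<times> H) B"
  proof (rule bij_betw_imageI)
    show "inj_on (\<lambda>(r, h). r \<circ> h) (rep ` B \<times> H)"
    proof (rule inj_onI, clarify)
      fix \<sigma> h \<tau> k assume *: "\<sigma> \<in> B" "h \<in> H" "\<tau> \<in> B" "k \<in> H" "rep \<sigma> \<circ> h = rep \<tau> \<circ> k"
      then have eq: "rep \<sigma> = rep \<tau>" using rep_rep by metis
      have "rep \<tau> \<in> G" using repB * subgroupD(1)[OF B] by blast
      moreover have "inv (rep \<tau>) \<circ> (rep \<tau> \<circ> h) = inv (rep \<tau>) \<circ> (rep \<tau> \<circ> k)" using * eq by simp
      ultimately have "h = k" by (simp add: comp_assoc[symmetric])
      then show "rep \<sigma> = rep \<tau> \<and> h = k" using eq by simp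
    qed
    show "(\<lambda>(r, h). r \<circ> h) ` (rep ` B \<times> H) = B"
    proof (intro equalityI subsetI)
      fix \<sigma> assume \<sigma>: "\<sigma> \<in> B"
      obtain h where h: "h \<in> H" "rep \<sigma> = \<sigma> \<circ> h" using rep[of \<sigma>] unfolding C_def by blast
      have hG: "h \<in> G" using subgroupD(1)[OF H] h by blast
      have "\<sigma> = rep \<sigma> \<circ> inv h" using hG h(2) by (simp add: comp_assoc)
      then show "\<sigma> \<in> (\<lambda>(r, h). r \<circ> h) ` (rep ` B \<times> H)"
        using \<sigma> subgroupD(4)[OF H h(1)] by (intro image_eqI[of _ _ "(rep \<sigma>, inv h)"]) auto
    next
      fix \<sigma> assume "\<sigma> \<in> (\<lambda>(r, h). r \<circ> h) ` (rep ` B \<times> H)"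
      then show "\<sigma> \<in> B" using repB HB subgroupD(3)[OF B] by auto
    qed
  qed
  then show ?thesis using that[of "rep ` B"] repB by blast
qed

lemma transversal_sum:
  assumes "bij_betw (\<lambda>(r, h). r \<circ> h) (R \<times> H) B"
  shows "(\<Sum>\<sigma>\<in>B. F \<sigma>) = (\<Sum>r\<in>R. \<Sum>h\<in>H. F (r \<circ> h))"
proof -
  have "(\<Sum>\<sigma>\<in>B. F \<sigma>) = (\<Sum>x\<in>R \<times> H. F (fst x \<circ> snd x))"
    using sum.reindex_bij_betw[OF assms, of F] by (simp add: case_prod_unfold)
  then show ?thesis by (simp add: sum.cartesian_product case_prod_unfold)
qed

lemma transversal_cover:
  assumes "bij_betw (\<lambda>(r, h). r \<circ> h) (R \<times> H) B" "\<sigma> \<in> B"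
  obtains r h where "r \<in> R" "h \<in> H" "\<sigma> = r \<circ> h"
proof -
  have "\<sigma> \<in> (\<lambda>(r, h). r \<circ> h) ` (R \<times> H)" using assms by (simp add: bij_betw_def)
  then show ?thesis using that by auto
qed

lemma transversal_distinct:
  assumes bij: "bij_betw (\<lambda>(r, h). r \<circ> h) (R \<times> H) B" and R: "R \<subseteq> G" and H: "is_subgroup H"
    and r: "r \<in> R" "r' \<in> R" "inv r \<circ> r' \<in> H"
  shows "r = r'"
proof -
  have "r \<circ> (inv r \<circ> r') = r' \<circ> id" using r R by (auto simp: comp_assoc[symmetric])
  then have "(r, inv r \<circ> r') = (r', id)"
    using bij r subgroupD(2)[OF H] unfolding bij_betw_def inj_on_def by force
  then show ?thesis by simp
qed

text \<open>Transitivity of the trace: each inner sum over \<open>H\<close> pulls out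
  \<open>w\<close> and leaves the \<open>H\<close>-trace of \<open>y\<close>.\<close>

lemma trace_fixed_mult:
  assumes bij: "bij_betw (\<lambda>(r, h). r \<circ> h) (R \<times> H) G" and R: "R \<subseteq> G" and H: "is_subgroup H"
    and w: "\<forall>h\<in>H. h w = w" and y: "(\<Sum>h\<in>H. h y) = 1"
  shows "(\<Sum>\<sigma>\<in>G. \<sigma> (w * y)) = (\<Sum>r\<in>R. r w)"
proof -
  have "(\<Sum>h\<in>H. (r \<circ> h) (w * y)) = r w" if "r \<in> R" for r
  proof -
    have rG: "r \<in> G" using that R by blast
    have "(\<Sum>h\<in>H. (r \<circ> h) (w * y)) = (\<Sum>h\<in>H. r w * r (h y))"
    proof (intro sum.cong refl)
      fix h assume h: "h \<in> H"
      then have "h \<in> G" "h w = w" using w subgroupD(1)[OF H] by auto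
      then show "(r \<circ> h) (w * y) = r w * r (h y)" using rG by (simp add: G_mult)
    qed
    also have "\<dots> = r w * r (\<Sum>h\<in>H. h y)" by (simp add: G_sum[OF rG] sum_distrib_left)
    finally show ?thesis by (simp add: y G_1[OF rG])
  qed
  then show ?thesis by (simp add: transversal_sum[OF bij] cong: sum.cong)
qed

end

section \<open>Weak ramification and the different\<close>

locale weak_extension = local_extension +
  assumes weak: "ram 2 = {id}" and wild: "ram 1 \<noteq> {id}"
    and fixed_K: "(\<forall>\<sigma>\<in>G. \<sigma> x = x) \<Longrightarrow> x \<in> K"
begin

text \<open>With \<open>f\<close> the minimal polynomial of \<open>\<pi>\<close> over the fixed field of \<open>H\<close>, this is Euler's
  formula \<open>Tr (\<pi> ^ (n - 1) / f' \<pi>) = 1\<close> where \<open>n = card H\<close>; the valuation of the different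
  \<open>f' \<pi>\<close> is bounded because the second ramification group is trivial.\<close>

lemma trace_one:
  assumes H: "is_subgroup H" and H0: "H \<subseteq> ram 0"
  obtains y where "(\<Sum>h\<in>H. h y) = 1" "ge (1 - int (card (ram 1))) y"
proof -
  note fin = subgroupD(5)[OF H] and idH = subgroupD(2)[OF H]
  have inj: "inj_on (\<lambda>\<sigma>. \<sigma> \<pi>) H" using ram_0_inj H0 by (rule inj_on_subset)
  have pos: "0 < card H" using fin idH by (auto simp: card_gt_0_iff)
  define D where "D = (\<Prod>t\<in>H - {id}. \<pi> - t \<pi>)"
  have nz: "\<pi> - t \<pi> \<noteq> 0" if "t \<in> H - {id}" for t
    using that H0 ram_0_fix_uniformizer by fastforce
  have Dnz: "D \<noteq> 0" using nz fin by (simp add: D_def)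
  define y where "y = \<pi> ^ (card H - 1) / D"
  \<comment> \<open>Left translation by \<open>h\<close> permutes \<open>H\<close>, so the
    conjugates of \<open>D\<close> are exactly the Lagrange denominators.\<close>
  have hD: "h D = (\<Prod>t\<in>H - {h}. h \<pi> - t \<pi>)" if h: "h \<in> H" for h
  proof -
    have hG: "h \<in> G" using h subgroupD(1)[OF H] by blast
    have "h D = (\<Prod>t\<in>H - {id}. h \<pi> - (h \<circ> t) \<pi>)" by (simp add: D_def G_prod[OF hG] G_diff[OF hG])
    also have "\<dots> = (\<Prod>t\<in>H - {h}. h \<pi> - t \<pi>)"
    proof (rule prod.reindex_bij_witness[of _ "\<lambda>t. inv h \<circ> t" "\<lambda>t. h \<circ> t"])
      fix t assume t: "t \<in> H - {id}"
      show "inv h \<circ> (h \<circ> t) = t" using hG by (simp add: comp_assoc[symmetric])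
      then show "h \<circ> t \<in> H - {h}" using t h hG subgroupD(3)[OF H] by auto
    next
      fix t assume t: "t \<in> H - {h}"
      show eq: "h \<circ> (inv h \<circ> t) = t" using hG by (simp add: comp_assoc[symmetric])
      then show "inv h \<circ> t \<in> H - {id}" using t h subgroupD(3,4)[OF H] by auto
    qed simp
    finally show ?thesis .
  qed
  have "(\<Sum>h\<in>H. h y) = (\<Sum>h\<in>H. h \<pi> ^ (card H - 1) / (\<Prod>t\<in>H - {h}. h \<pi> - t \<pi>))"
    using subgroupD(1)[OF H] hD by (intro sum.cong) (auto simp: y_def G_divide G_power)
  also have "\<dots> = 1" using lagrange_power_sum[OF fin inj, of "card H - 1"] pos by simp
  finally have tr: "(\<Sum>h\<in>H. h y) = 1" .
  \<comment> \<open>As \<open>ram 2\<close> is trivial, each nontrivial element of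
    \<open>ram 1\<close> contributes at most 2 to \<open>v D\<close> and every other one at most 1.
    Hence \<open>v D\<close> is at most \<open>(card H - 1) + (card (ram 1) - 1)\<close>.\<close>
  have vt: "v (\<pi> - t \<pi>) \<le> 1 + (if t \<in> ram 1 then 1 else 0)" if t: "t \<in> H - {id}" for t
  proof -
    have t0: "t \<in> ram 0" using t H0 by auto
    have "t \<notin> ram 2" using t weak by auto
    then have "\<not> ge 3 (\<pi> - t \<pi>)" using ram_iff_uniformizer[OF t0, of 2] ge_minus_commute by simp
    moreover have "\<not> ge 2 (\<pi> - t \<pi>)" if "t \<notin> ram 1"
      using that ram_iff_uniformizer[OF t0, of 1] ge_minus_commute by simp
    ultimately show ?thesis using not_geD by fastforce
  qed
  have fin1: "finite (ram 1)" using subgroupD(5)[OF subgroup_ram] .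
  have id1: "id \<in> ram 1" using subgroupD(2)[OF subgroup_ram] .
  have "v D = (\<Sum>t\<in>H - {id}. v (\<pi> - t \<pi>))"
    unfolding D_def using fin nz by (intro v_prod) auto
  also have "\<dots> \<le> (\<Sum>t\<in>H - {id}. 1 + (if t \<in> ram 1 then 1 else 0))" using vt by (intro sum_mono)
  also have "\<dots> = int (card (H - {id})) + int (card ((H - {id}) \<inter> ram 1))"
    using fin by (simp add: sum.distrib sum.inter_restrict[symmetric])
  also have "card ((H - {id}) \<inter> ram 1) \<le> card (ram 1 - {id})" using fin1 by (intro card_mono) auto
  finally have "v D \<le> int (card H - 1) + int (card (ram 1) - 1)"
    using card_Diff_singleton[OF idH] card_Diff_singleton[OF id1] by linarith
  moreover have "0 < card (ram 1)" using fin1 id1 by (auto simp: card_gt_0_iff)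
  ultimately have "1 - int (card (ram 1)) \<le> v y"
    using Dnz pos by (simp add: y_def v_divide v_power)
  then have "ge (1 - int (card (ram 1))) y" by (simp add: vge_def)
  then show ?thesis using that tr by blast
qed

subsection \<open>The wild inertia group\<close>

lemma ram_1_ram_0: "\<sigma> \<in> ram 1 \<Longrightarrow> \<sigma> \<in> ram 0"
  using ram_antimono[of 0 1] by auto

text \<open>Writing \<open>d = c * \<pi>\<^sup>2\<close> reduces the claim to \<open>c\<close> and
  \<open>\<pi>\<close>. Thus \<open>ram 1\<close> acts trivially on P^2 / P^3, where the leading
  terms \<open>\<sigma> \<pi> - \<pi>\<close> live.\<close>

lemma ram_1_shift:
  assumes \<sigma>: "\<sigma> \<in> ram 1" and d: "ge 2 d"
  shows "ge 3 (\<sigma> d - d)"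
proof -
  have \<sigma>G: "\<sigma> \<in> G" using \<sigma> ram_G by blast
  define c where "c = d / \<pi>\<^sup>2"
  have c: "ge 0 c" using ge_divide[of "\<pi>\<^sup>2" 2 d] d by (simp add: c_def v_power)
  have \<pi>: "ge 1 \<pi>" "ge 1 (\<sigma> \<pi>)" using \<sigma>G by (simp_all add: vge_def v_G)
  have "d = c * \<pi>\<^sup>2" by (simp add: c_def)
  then have eq: "\<sigma> d - d = (\<sigma> c - c) * (\<sigma> \<pi> * \<sigma> \<pi>) + c * ((\<sigma> \<pi> - \<pi>) * (\<sigma> \<pi> + \<pi>))"
    using \<sigma>G by (simp add: G_mult power2_eq_square algebra_simps)
  have 1: "ge (2 + (1 + 1)) ((\<sigma> c - c) * (\<sigma> \<pi> * \<sigma> \<pi>))"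
    using ram_ge[OF \<sigma> c] \<pi> by (intro ge_mult) auto
  have "ge (2 + 1) ((\<sigma> \<pi> - \<pi>) * (\<sigma> \<pi> + \<pi>))"
    using ram_ge[OF \<sigma>, of \<pi>] \<pi> ge_mono[OF \<pi>(1), of 0] by (intro ge_mult ge_add) auto
  then have 2: "ge 3 (c * ((\<sigma> \<pi> - \<pi>) * (\<sigma> \<pi> + \<pi>)))" using c by (simp add: ge_mult_left)
  show ?thesis unfolding eq using ge_mono[OF 1, of 3] 2 by (intro ge_add) auto
qed

lemma ram_1_uniformizer: "\<sigma> \<in> ram 1 \<Longrightarrow> ge 2 (\<sigma> \<pi> - \<pi>)"
  using ram_ge[of \<sigma> 1 \<pi>] by (simp add: vge_def)

text \<open>Sending \<open>\<sigma>\<close> to \<open>\<sigma> \<pi> - \<pi>\<close> is a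
  homomorphism from \<open>ram 1\<close> to the additive group P^2 / P^3. Together with its
  injectivity in \<open>ram_1_eqI\<close> this shows that \<open>ram 1\<close> is elementary
  abelian.\<close>

lemma ram_1_additive:
  assumes "\<sigma> \<in> ram 1" "\<tau> \<in> ram 1"
  shows "ge 3 ((\<sigma> (\<tau> \<pi>) - \<pi>) - ((\<sigma> \<pi> - \<pi>) + (\<tau> \<pi> - \<pi>)))"
proof -
  have "(\<sigma> (\<tau> \<pi>) - \<pi>) - ((\<sigma> \<pi> - \<pi>) + (\<tau> \<pi> - \<pi>)) = \<sigma> (\<tau> \<pi> - \<pi>) - (\<tau> \<pi> - \<pi>)"
    using ram_G[OF assms(1)] by (simp add: G_diff)
  then show ?thesis using ram_1_shift[OF assms(1) ram_1_uniformizer[OF assms(2)]] by (simp only:)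
qed

text \<open>The quotient of the two automorphisms moves \<open>\<pi>\<close> only modulo P^3, so it
  lies in the trivial group \<open>ram 2\<close>.\<close>

lemma ram_1_eqI:
  assumes \<sigma>: "\<sigma> \<in> ram 1" and \<tau>: "\<tau> \<in> ram 1" and eq: "ge 3 (\<sigma> \<pi> - \<tau> \<pi>)"
  shows "\<sigma> = \<tau>"
proof -
  have \<tau>G: "\<tau> \<in> G" using \<tau> ram_G by blast
  note sub = subgroupD[OF subgroup_ram]
  have \<rho>: "inv \<tau> \<circ> \<sigma> \<in> ram 1" using \<sigma> \<tau> sub(3,4) by blast
  have "ge 3 (inv \<tau> (\<sigma> \<pi> - \<tau> \<pi>))" using eq G_inv[OF \<tau>G] by simp
  then have "ge 3 ((inv \<tau> \<circ> \<sigma>) \<pi> - \<pi>)" using G_inv[OF \<tau>G] \<tau>G by (simp add: G_diff)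
  then have "inv \<tau> \<circ> \<sigma> \<in> ram 2" using ram_iff_uniformizer[OF ram_1_ram_0[OF \<rho>], of 2] by simp
  then have "inv \<tau> \<circ> \<sigma> = id" using weak by simp
  then have "\<tau> \<circ> (inv \<tau> \<circ> \<sigma>) = \<tau>" by simp
  then show ?thesis using \<tau>G by (simp add: comp_assoc[symmetric])
qed

lemma ram_1_comp: "\<sigma> \<in> ram 1 \<Longrightarrow> \<tau> \<in> ram 1 \<Longrightarrow> \<sigma> \<circ> \<tau> \<in> ram 1"
  using subgroupD(3)[OF subgroup_ram] .

lemma ram_1_commute:
  assumes \<sigma>: "\<sigma> \<in> ram 1" and \<tau>: "\<tau> \<in> ram 1"
  shows "\<sigma> \<circ> \<tau> = \<tau> \<circ> \<sigma>"
proof (rule ram_1_eqI)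
  show "ge 3 ((\<sigma> \<circ> \<tau>) \<pi> - (\<tau> \<circ> \<sigma>) \<pi>)"
    using ge_diff[OF ram_1_additive[OF \<sigma> \<tau>] ram_1_additive[OF \<tau> \<sigma>]] by (simp add: algebra_simps)
qed (use assms ram_1_comp in auto)

lemma ram_1_funpow: "\<sigma> \<in> ram 1 \<Longrightarrow> \<sigma> ^^ n \<in> ram 1"
proof (induction n)
  case 0
  then show ?case using subgroupD(2)[OF subgroup_ram] by (simp add: id_def)
qed (auto intro: ram_1_comp)

lemma ram_1_exponent:
  assumes \<sigma>: "\<sigma> \<in> ram 1"
  shows "\<sigma> ^^ q = id"
proof -
  have mult: "ge 3 (((\<sigma> ^^ n) \<pi> - \<pi>) - of_nat n * (\<sigma> \<pi> - \<pi>))" for n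
  proof (induction n)
    case (Suc n)
    have "ge 3 ((\<sigma> ((\<sigma> ^^ n) \<pi>) - \<pi>) - ((\<sigma> \<pi> - \<pi>) + ((\<sigma> ^^ n) \<pi> - \<pi>)))"
      by (intro ram_1_additive \<sigma> ram_1_funpow)
    from ge_add[OF this Suc] show ?case by (simp add: algebra_simps)
  qed simp
  have "ge (1 + 2) (of_nat q * (\<sigma> \<pi> - \<pi>))" by (intro ge_mult ge_q ram_1_uniformizer \<sigma>)
  then have "ge 3 ((\<sigma> ^^ q) \<pi> - id \<pi>)" using ge_add[OF mult[of q]] by fastforce
  then show ?thesis
    using \<sigma> subgroupD(2)[OF subgroup_ram] by (intro ram_1_eqI ram_1_funpow)
qed

text \<open>A largest subset \<open>A\<close> that contains \<open>id\<close>, is closed under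
  composition and has \<open>q\<close>-power size must be everything: adjoining the powers of some
  \<open>g\<close> outside \<open>A\<close> multiplies the size by \<open>q\<close>. Inverses are
  powers, so closure under composition suffices.\<close>

lemma card_ram_1: "\<exists>s. card (ram 1) = q ^ s"
proof -
  have fin: "finite (ram 1)" using subgroupD(5)[OF subgroup_ram] .
  define P where "P A \<longleftrightarrow> A \<subseteq> ram 1 \<and> id \<in> A \<and> (\<forall>a\<in>A. \<forall>b\<in>A. a \<circ> b \<in> A) \<and> (\<exists>s. card A = q ^ s)" for A
  have "P {id}" using subgroupD(2)[OF subgroup_ram] by (auto simp: P_def intro: exI[of _ 0])
  moreover have "\<forall>A. P A \<longrightarrow> card A < Suc (card (ram 1))"
    using card_mono[OF fin] by (auto simp: P_def le_imp_less_Suc)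
  ultimately have "\<exists>A. P A \<and> (\<forall>B. P B \<longrightarrow> card B \<le> card A)" by (rule ex_has_greatest_nat)
  then obtain A where A: "P A" and max: "\<And>B. P B \<Longrightarrow> card B \<le> card A" by blast
  have A1: "A \<subseteq> ram 1" "id \<in> A" "\<And>a b. a \<in> A \<Longrightarrow> b \<in> A \<Longrightarrow> a \<circ> b \<in> A"
    using A by (auto simp: P_def)
  obtain s where s: "card A = q ^ s" using A by (auto simp: P_def)
  have powA: "a ^^ n \<in> A" if "a \<in> A" for a n
  proof (induction n)
    case (Suc n)
    then show ?case unfolding funpow.simps by (rule A1(3)[OF that])
  qed (use A1(2) in \<open>simp add: id_def\<close>)
  have "A = ram 1"
  proof (rule ccontr)
    assume "A \<noteq> ram 1"
    then obtain g where g: "g \<in> ram 1" "g \<notin> A" using A1(1) by blast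
    define F where "F = (\<lambda>(a :: 'a \<Rightarrow> 'a, j). a \<circ> g ^^ j)"
    define B where "B = F ` (A \<times> {..<q})"
    have gpow: "g ^^ (j mod q) = g ^^ j" for j
    proof -
      have "g ^^ j = g ^^ (q * (j div q) + j mod q)" by simp
      also have "\<dots> = (g ^^ q) ^^ (j div q) \<circ> g ^^ (j mod q)" by (simp only: funpow_add funpow_mult)
      finally show ?thesis using ram_1_exponent[OF g(1)] by simp
    qed
    have inB: "a \<circ> g ^^ j \<in> B" if "a \<in> A" for a j
      unfolding B_def F_def using that prime_gt_0_nat[OF prime_q] gpow[of j]
      by (intro image_eqI[of _ _ "(a, j mod q)"]) auto
    have "inj_on F (A \<times> {..<q})"
    proof -
      \<comment> \<open>A collision puts \<open>g ^^ (j - i)\<close> into \<open>A\<close>, with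
        \<open>b ^^ (q - 1)\<close> acting as the inverse of \<open>b\<close>. As
        \<open>j - i\<close> is invertible modulo \<open>q\<close>, \<open>g\<close> itself would
        lie in \<open>A\<close>.\<close>
      have no: False if *: "a \<in> A" "b \<in> A" "i < j" "j < q" "a \<circ> g ^^ i = b \<circ> g ^^ j" for a b i j
      proof -
        have bG: "b \<in> ram 1" using * A1(1) by auto
        define d where "d = j - i"
        have j: "j = d + i" using * by (simp add: d_def)
        have bq: "b ^^ (q - 1) \<circ> b = id"
          using ram_1_exponent[OF bG] prime_gt_0_nat[OF prime_q]
          by (metis Suc_diff_1 funpow_Suc_right)
        have "g ^^ i \<in> G" using g(1) ram_1_funpow ram_G by blast
        then have surj: "surj (g ^^ i)" by (simp add: G_bij bij_is_surj)
        have "a \<circ> g ^^ i = (b \<circ> g ^^ d) \<circ> g ^^ i" using *(5) by (simp add: j funpow_add comp_assoc)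
        then have "a = b \<circ> g ^^ d" using surj by (metis surj_fun_eq)
        then have "b ^^ (q - 1) \<circ> a = g ^^ d" using bq by (simp add: comp_assoc[symmetric])
        then have gd: "g ^^ d \<in> A" using A1(3)[OF powA[OF *(2)] *(1)] by metis
        have "coprime d q"
          using prime_q * by (intro prime_imp_coprime_nat[THEN coprime_commute[THEN iffD1]])
            (auto simp: d_def dest: dvd_imp_le)
        moreover have "d \<noteq> 0" using * by (simp add: d_def)
        ultimately obtain u z where "d * u = q * z + 1" using bezout_nat[of d q] by (auto simp: coprime_iff_gcd_eq_1)
        then have "(d * u) mod q = 1" using prime_gt_1_nat[OF prime_q] by (simp only: mod_mult_self4 mod_less)
        then have "g ^^ (d * u) = g" using gpow[of "d * u"] by simp
        then have "g \<in> A" using powA[OF gd, of u] by (simp add: funpow_mult)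
        then show False using g(2) by simp
      qed
      show ?thesis
      proof (rule inj_onI)
        fix x y assume xy: "x \<in> A \<times> {..<q}" "y \<in> A \<times> {..<q}" "F x = F y"
        obtain a i b j where eq: "x = (a, i)" "y = (b, j)" by (cases x, cases y)
        have *: "a \<in> A" "i < q" "b \<in> A" "j < q" "a \<circ> g ^^ i = b \<circ> g ^^ j"
          using xy by (auto simp: eq F_def)
        have "\<not> i < j" using no[of a b i j] * by blast
        moreover have "\<not> j < i" using no[of b a j i] *(1-4) *(5)[symmetric] by blast
        ultimately have ij: "i = j" by simp
        have "g ^^ j \<in> G" using g(1) ram_1_funpow ram_G by blast
        then have "surj (g ^^ j)" by (simp add: G_bij bij_is_surj)
        then have "a = b" using ij *(5) by (metis surj_fun_eq)
        then show "x = y" using ij by (simp add: eq)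
      qed
    qed
    then have "card B = q ^ Suc s" using s by (simp add: B_def card_image card_cartesian_product)
    moreover have "B \<subseteq> ram 1"
      using A1(1) g(1) ram_1_comp ram_1_funpow by (auto simp: B_def F_def)
    moreover have "id \<in> B" using inB[OF A1(2), of 0] by (simp only: funpow.simps comp_id)
    moreover have "x \<circ> y \<in> B" if xy: "x \<in> B" "y \<in> B" for x y
    proof -
      obtain a i b j where *: "a \<in> A" "b \<in> A" "x = a \<circ> g ^^ i" "y = b \<circ> g ^^ j"
        using xy by (auto simp: B_def F_def)
      have "g ^^ i \<circ> b = b \<circ> g ^^ i" using * A1(1) g(1) by (intro ram_1_commute ram_1_funpow) auto
      then have "x \<circ> y = (a \<circ> b) \<circ> g ^^ (i + j)"
        unfolding *(3,4) funpow_add by (metis comp_assoc)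
      then show ?thesis using inB[OF A1(3)[OF *(1,2)]] by simp
    qed
    ultimately have "P B" "card B = q ^ Suc s" unfolding P_def by blast+
    then have "q ^ Suc s \<le> q ^ s" using max[of B] s by simp
    then show False using prime_gt_1_nat[OF prime_q] by simp
  qed
  then show ?thesis using s by blast
qed

text \<open>Wild ramification enters here: it excludes \<open>s = 0\<close> in
  \<open>card (ram 1) = q ^ s\<close>.\<close>

lemma of_nat_card_ram_1: "ge 1 (of_nat (card (ram 1)))"
proof -
  obtain s where s: "card (ram 1) = q ^ s" using card_ram_1 by blast
  have "s \<noteq> 0"
  proof
    assume "s = 0"
    then have "card (ram 1) = 1" using s by simp
    then obtain g where g: "ram 1 = {g}" by (rule card_1_singletonE)
    have "id \<in> ram 1" using subgroupD(2)[OF subgroup_ram] .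
    then show False using wild g by auto
  qed
  then have "card (ram 1) = q * q ^ (s - 1)" using s by (cases s) auto
  then show ?thesis using ge_q by (simp add: ge_mult_right ge_power ge_of_nat)
qed

lemma of_nat_card_ram_0: "ge 1 (of_nat (card (ram 0)))"
proof -
  obtain R where R: "bij_betw (\<lambda>(r, h). r \<circ> h) (R \<times> ram 1) (ram 0)"
    using transversal_exists[OF subgroup_ram subgroup_ram ram_antimono[of 0 1]] by auto
  have "card (ram 0) = card R * card (ram 1)"
    using bij_betw_same_card[OF R] by (simp add: card_cartesian_product)
  then show ?thesis using of_nat_card_ram_1 by (simp add: ge_mult_left ge_of_nat)
qed

section \<open>Inertia, its fixed field and its trace\<close>

text \<open>Every residue class has a representative fixed by inertia, so the action on the residue
  field is visible on inertia-fixed units.\<close>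

lemma ram_0_detect:
  assumes \<rho>: "\<rho> \<in> G" and w: "\<And>w. w \<noteq> 0 \<Longrightarrow> v w = 0 \<Longrightarrow> \<forall>h\<in>ram 0. h w = w \<Longrightarrow> ge 1 (\<rho> w - w)"
  shows "\<rho> \<in> ram 0"
proof (rule ramI[OF \<rho>])
  fix x assume x: "ge 0 x"
  obtain \<omega> where \<omega>: "ge 0 \<omega>" "ge 1 (x - \<omega>)" "\<And>\<sigma>. \<sigma> \<in> ram 0 \<Longrightarrow> \<sigma> \<omega> = \<omega>"
    using teichmueller[OF x] by blast
  have "ge 1 (\<rho> \<omega> - \<omega>)"
  proof (cases "ge 1 \<omega>")
    case True
    then show ?thesis using \<rho> by (intro ge_diff) auto
  next
    case False
    then have "\<omega> \<noteq> 0" "v \<omega> = 0" using \<omega>(1) by (auto simp: vge_def)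
    then show ?thesis using w \<omega>(3) by blast
  qed
  moreover have "ge 1 (\<rho> x - \<rho> \<omega>)" using \<omega>(2) \<rho> by (simp flip: G_diff)
  moreover have "ge 1 (\<omega> - x)" using \<omega>(2) ge_minus_commute by blast
  ultimately show "ge (0 + 1) (\<rho> x - x)" using ge_trans by (metis add_0)
qed

lemma subgroup_sum_shift:
  assumes H: "is_subgroup H" and \<tau>: "\<tau> \<in> H"
  shows "(\<Sum>\<sigma>\<in>H. F (\<tau> \<circ> \<sigma>)) = (\<Sum>\<sigma>\<in>H. F \<sigma>)"
proof -
  have \<tau>G: "\<tau> \<in> G" using H \<tau> subgroupD(1) by blast
  show ?thesis
    by (rule sum.reindex_bij_witness[of _ "\<lambda>\<sigma>. inv \<tau> \<circ> \<sigma>" "\<lambda>\<sigma>. \<tau> \<circ> \<sigma>"])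
      (use \<tau>G \<tau> subgroupD(3,4)[OF H] in \<open>auto simp: comp_assoc[symmetric]\<close>)
qed

lemma trace_fixed:
  assumes H: "is_subgroup H" and \<tau>: "\<tau> \<in> H"
  shows "\<tau> (\<Sum>\<sigma>\<in>H. \<sigma> x) = (\<Sum>\<sigma>\<in>H. \<sigma> x)"
proof -
  have "\<tau> \<in> G" using H \<tau> subgroupD(1) by blast
  then show ?thesis using subgroup_sum_shift[OF H \<tau>, of "\<lambda>\<sigma>. \<sigma> x"] by (simp add: G_sum)
qed

lemma trace_in_K: "(\<Sum>\<sigma>\<in>G. \<sigma> x) \<in> K"
  using trace_fixed[OF subgroup_G] by (intro fixed_K) auto

text \<open>In other words, the fixed field of the inertia group is unramified over \<open>K\<close>.\<close>

lemma v_p_le_fixed_ram_0: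
  assumes y: "y \<noteq> 0" "0 < v y" "\<forall>h\<in>ram 0. h y = y"
  shows "v p \<le> v y"
proof -
  note sub = subgroup_ram[of 0]
  obtain R where R: "R \<subseteq> G" "bij_betw (\<lambda>(r, h). r \<circ> h) (R \<times> ram 0) G"
    using transversal_exists[OF sub subgroup_G] subgroupD(1)[OF sub] by blast
  obtain y0 where y0: "(\<Sum>h\<in>ram 0. h y0) = 1" using trace_one[OF sub] by blast
  define U where "U = {w. w \<noteq> 0 \<and> v w = 0 \<and> (\<forall>h\<in>ram 0. h w = w)}"
  have finR: "finite R" using R(1) finite_G finite_subset by blast
  have b: "ge 0 (r y / y) \<and> \<not> ge 1 (r y / y)" if "r \<in> R" for r
  proof -
    have "r \<in> G" using that R(1) by blast
    then show ?thesis using y by (simp add: vge_def v_divide v_G G_eq_0_iff)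
  qed
  \<comment> \<open>Otherwise the reductions of the coset representatives, which are distinct
    characters on \<open>U\<close>, would satisfy a linear relation with the unit coefficients
    \<open>r y / y\<close>.\<close>
  have "\<exists>w\<in>U. \<not> ge 1 (\<Sum>r\<in>R. r y / y * r w)"
  proof (rule ccontr)
    assume "\<not> ?thesis"
    then have rel: "ge 1 (\<Sum>r\<in>R. r y / y * r w)" if "w \<in> U" for w using that by blast
    obtain r where r: "r \<in> R" using transversal_cover[OF R(2) G_id] by blast
    have "ge 1 (r y / y)"
    proof (rule characters_independent[where U = U and \<chi> = "\<lambda>r. r" and I = R and b = "\<lambda>r. r y / y"])
      have "1 \<in> U" using ram_G G_1 by (auto simp: U_def)
      then show "U \<noteq> {}" by blast
      show "x * z \<in> U" if "x \<in> U" "z \<in> U" for x z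
        using that ram_G by (auto simp: U_def v_mult G_mult)
      show "ge 0 (s x) \<and> \<not> ge 1 (s x)" if "s \<in> R" "x \<in> U" for s x
      proof -
        have "s \<in> G" "x \<noteq> 0" "v x = 0" using that R(1) by (auto simp: U_def)
        then show ?thesis by (simp add: vge_def G_eq_0_iff v_G)
      qed
      show "s (x * z) = s x * s z" if "s \<in> R" for s x z
        using that R(1) G_mult by blast
      show "\<exists>x\<in>U. \<not> ge 1 (s x - t x)" if st: "s \<in> R" "t \<in> R" "s \<noteq> t" for s t
      proof (rule ccontr)
        assume "\<not> ?thesis"
        then have cong: "ge 1 (s x - t x)" if "x \<in> U" for x using that by blast
        have sG: "s \<in> G" and tG: "t \<in> G" using st R(1) by auto
        have "inv s \<circ> t \<in> ram 0"
        proof (rule ram_0_detect)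
          show "inv s \<circ> t \<in> G" using sG tG by (intro G_comp G_inv)
          fix w assume "w \<noteq> 0" "v w = 0" "\<forall>h\<in>ram 0. h w = w"
          then have "ge 1 (t w - s w)" using cong ge_minus_commute by (auto simp: U_def)
          then have "ge 1 (inv s (t w - s w))" using G_inv[OF sG] by simp
          then show "ge 1 ((inv s \<circ> t) w - w)" using sG G_inv[OF sG] by (simp add: G_diff)
        qed
        then show False using transversal_distinct[OF R(2,1) sub st(1,2)] st(3) by blast
      qed
    qed (use finR b rel r in auto)
    then show False using b[OF r] by blast
  qed
  then obtain w where w: "w \<in> U" and nw: "\<not> ge 1 (\<Sum>r\<in>R. r y / y * r w)" by blast
  define S where "S = (\<Sum>r\<in>R. r y / y * r w)"
  have "ge 0 S" unfolding S_def
  proof (rule ge_sum)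
    fix r assume r: "r \<in> R"
    then have "r \<in> G" using R(1) by blast
    moreover have "ge 0 w" using w by (simp add: U_def vge_def)
    ultimately have "ge 0 (r w)" by simp
    then show "ge 0 (r y / y * r w)" using b[OF r] by (intro ge_mult_left) auto
  qed
  then have S: "S \<noteq> 0" "v S = 0" using nw by (auto simp: S_def vge_def)
  \<comment> \<open>This full trace lies in \<open>K\<close> and equals \<open>y * S\<close> with
    \<open>S\<close> a unit, so it has the valuation of \<open>y\<close>.\<close>
  have "(\<Sum>\<sigma>\<in>G. \<sigma> ((w * y) * y0)) = (\<Sum>r\<in>R. r (w * y))"
    using w y(3) ram_G by (intro trace_fixed_mult[OF R(2,1) sub _ y0]) (auto simp: U_def G_mult)
  also have "\<dots> = y * S"
    unfolding S_def sum_distrib_left using R(1) y(1) by (intro sum.cong) (auto simp: G_mult)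
  finally have "y * S \<in> K" using trace_in_K by metis
  then have "v p \<le> v (y * S)" using y S by (intro v_p_le) (auto simp: v_mult)
  then show ?thesis using y S by (simp add: v_mult)
qed

text \<open>Modulo \<open>P\<close> every \<open>h x\<close> equals \<open>x\<close>, so the trace
  is congruent to \<open>card (ram 0) * x\<close>, hence to zero. Being fixed by inertia, it then
  has valuation at least \<open>v p\<close>.\<close>

lemma trace_ram_0:
  assumes x: "ge 0 x"
  shows "ge (v p) (\<Sum>h\<in>ram 0. h x)"
proof -
  let ?T = "\<Sum>h\<in>ram 0. h x"
  have "?T = (\<Sum>h\<in>ram 0. h x - x) + of_nat (card (ram 0)) * x" by (simp add: sum_subtractf)
  moreover have "ge 1 (\<Sum>h\<in>ram 0. h x - x)" using ram_ge[of _ 0 x] x by (intro ge_sum) auto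
  moreover have "ge 1 (of_nat (card (ram 0)) * x)" using of_nat_card_ram_0 x by (rule ge_mult_right)
  ultimately have T: "ge 1 ?T" using ge_add by metis
  show ?thesis
  proof (cases "?T = 0")
    case False
    have "v p \<le> v ?T"
      using T False trace_fixed[OF subgroup_ram] by (intro v_p_le_fixed_ram_0) (auto simp: vge_def)
    then show ?thesis by (simp add: vge_def)
  qed simp
qed

text \<open>The norm \<open>W\<close> of \<open>\<pi>\<close> from \<open>L\<close> to the fixed field of \<open>ram 1\<close> detects the tame
  character: \<open>\<sigma> W / W\<close> is congruent to the \<open>card (ram 1)\<close>-th power of \<open>\<sigma> \<pi> / \<pi>\<close>.\<close>

lemma ram_1_detect:
  assumes \<sigma>: "\<sigma> \<in> G"
    and w: "\<And>w. w \<noteq> 0 \<Longrightarrow> \<forall>g\<in>ram 1. g w = w \<Longrightarrow> ge 1 (\<sigma> w / w - 1)"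
  shows "\<sigma> \<in> ram 1"
proof -
  have \<sigma>0: "\<sigma> \<in> ram 0"
  proof (rule ram_0_detect[OF \<sigma>])
    fix u assume u: "u \<noteq> 0" "v u = 0" "\<forall>h\<in>ram 0. h u = u"
    then have "ge 1 (\<sigma> u / u - 1)" using ram_1_ram_0 by (intro w) auto
    then have "ge 1 (u * (\<sigma> u / u - 1))" using u by (intro ge_mult_left) (auto simp: vge_def)
    then show "ge 1 (\<sigma> u - u)" using u by (simp add: algebra_simps)
  qed
  note sub = subgroup_ram[of 1]
  define W where "W = (\<Prod>g\<in>ram 1. g \<pi>)"
  define \<zeta> where "\<zeta> = \<sigma> \<pi> / \<pi>"
  define E where "E = (\<Prod>g\<in>ram 1. g \<pi> / \<pi>)"
  have gnz: "g \<pi> \<noteq> 0" if "g \<in> G" for g using that G_eq_0_iff by simp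
  have fin: "finite (ram 1)" using subgroupD(5)[OF sub] .
  have W: "W \<noteq> 0" using fin gnz ram_G by (auto simp: W_def)
  have "g W = W" if g: "g \<in> ram 1" for g
  proof -
    have gG: "g \<in> G" using g ram_G by blast
    have "g W = (\<Prod>h\<in>ram 1. (g \<circ> h) \<pi>)" by (simp add: W_def G_prod[OF gG])
    also have "\<dots> = W" unfolding W_def
      by (rule prod.reindex_bij_witness[of _ "\<lambda>\<sigma>. inv g \<circ> \<sigma>" "\<lambda>\<sigma>. g \<circ> \<sigma>"])
        (use gG g subgroupD(3,4)[OF sub] in \<open>auto simp: comp_assoc[symmetric]\<close>)
    finally show ?thesis .
  qed
  then have 1: "ge 1 (\<sigma> W / W - 1)" using W by (intro w) auto
  have WE: "W = \<pi> ^ card (ram 1) * E"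
    by (simp add: W_def E_def prod_dividef)
  have E1: "ge 1 (E - 1)"
    unfolding E_def
  proof (rule cong_prod_1)
    fix g assume "g \<in> ram 1"
    then have "ge (2 - v \<pi>) ((g \<pi> - \<pi>) / \<pi>)" by (intro ge_divide ram_1_uniformizer) auto
    then show "ge 1 (g \<pi> / \<pi> - 1)" by (simp add: diff_divide_distrib)
  qed
  have E: "E \<noteq> 0" using WE W by auto
  have E0: "ge 0 E" using ge_add[OF ge_mono[OF E1, of 0], of 1] by simp
  have \<sigma>E: "ge 1 (\<sigma> E - 1)" using E1 \<sigma> by (metis G_1 G_diff ge_G)
  have \<zeta>: "ge 0 \<zeta>" using \<sigma> gnz by (simp add: \<zeta>_def vge_def v_divide v_G)
  define n where "n = card (ram 1)"
  have "\<sigma> W / W = \<zeta> ^ n * (\<sigma> E / E)"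
    using \<sigma> by (simp add: WE \<zeta>_def n_def G_mult G_power power_divide)
  then have "\<sigma> W / W * E = \<zeta> ^ n * \<sigma> E" using E by simp
  moreover have "ge 0 (\<sigma> W / W)" using ge_add[OF ge_mono[OF 1, of 0], of 1] by simp
  then have "ge 1 (\<sigma> W / W * E - 1 * 1)" using 1 E1 by (intro cong_mult) auto
  ultimately have "ge 1 (\<zeta> ^ n * \<sigma> E - 1)" by simp
  moreover have "ge 1 (\<zeta> ^ n * \<sigma> E - \<zeta> ^ n)"
    using ge_mult_left[OF ge_power[OF \<zeta>, of n] \<sigma>E] by (simp add: algebra_simps)
  ultimately have "ge 1 (\<zeta> ^ n - 1)" using ge_diff by fastforce
  \<comment> \<open>The exponent \<open>n\<close> is a power of \<open>q\<close>, so injectivity of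
    Frobenius removes it.\<close>
  then have "ge 1 (\<zeta> - 1)"
    using card_ram_1 frobenius_power_cong_1[OF prime_q ge_q \<zeta>] by (auto simp: n_def)
  then have "ge (1 + 1) (\<pi> * (\<zeta> - 1))" by (intro ge_mult) (simp_all add: vge_def)
  then have "ge 2 (\<sigma> \<pi> - \<pi>)" by (simp add: \<zeta>_def algebra_simps)
  then show ?thesis using ram_iff_uniformizer[OF \<sigma>0, of 1] by simp
qed

subsection \<open>Faithfulness of the reduced group ring\<close>

text \<open>For \<open>g\<close> in \<open>G\<close>, this is right multiplication by
  \<open>inv g - 1\<close> in the group ring, written on coefficients.\<close>

definition shift :: "('a \<Rightarrow> 'a) \<Rightarrow> (('a \<Rightarrow> 'a) \<Rightarrow> 'a) \<Rightarrow> (('a \<Rightarrow> 'a) \<Rightarrow> 'a)" where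
  "shift g b = (\<lambda>\<sigma>. b (\<sigma> \<circ> g) - b \<sigma>)"

lemma shift_commute:
  assumes "g \<in> ram 1" "h \<in> ram 1"
  shows "shift g (shift h b) = shift h (shift g b)"
  by (simp add: shift_def comp_assoc ram_1_commute[OF assms] algebra_simps)

text \<open>Modulo \<open>q\<close>, the \<open>q\<close>-th power of \<open>inv g - 1\<close> is
  the difference of \<open>q\<close>-th powers, which vanishes because \<open>g\<close> has exponent
  \<open>q\<close>.\<close>

lemma shift_nilpotent:
  assumes g: "g \<in> ram 1" and b: "\<And>\<sigma>. \<sigma> \<in> G \<Longrightarrow> ge 0 (b \<sigma>)" and \<sigma>: "\<sigma> \<in> G"
  shows "ge 1 ((shift g ^^ q) b \<sigma>)"
proof -
  define f where "f j = b (\<sigma> \<circ> g ^^ j)" for j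
  have comm: "g ^^ i \<circ> g = g ^^ Suc i" for i by (rule funpow_Suc_right[symmetric])
  have "((\<lambda>f n. f (Suc n) - f n) ^^ k) f i = (shift g ^^ k) b (\<sigma> \<circ> g ^^ i)" for k i
  proof (induction k arbitrary: i)
    case (Suc k)
    have "((\<lambda>f n. f (Suc n) - f n) ^^ Suc k) f i
        = (shift g ^^ k) b (\<sigma> \<circ> g ^^ Suc i) - (shift g ^^ k) b (\<sigma> \<circ> g ^^ i)"
      unfolding Suc.IH[symmetric] by simp
    also have "\<dots> = shift g ((shift g ^^ k) b) (\<sigma> \<circ> g ^^ i)"
      by (simp only: shift_def comp_assoc comm)
    also have "shift g ((shift g ^^ k) b) = (shift g ^^ Suc k) b" by simp
    finally show ?case .
  qed (simp add: f_def)
  from this[of q 0] have eq: "(shift g ^^ q) b \<sigma> = (\<Sum>j\<le>q. of_nat (q choose j) * (-1) ^ (q - j) * f j)"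
    by (simp add: iterated_difference)
  have q0: "0 < q" using prime_gt_0_nat[OF prime_q] .
  have f: "ge 0 (f j)" for j
    unfolding f_def using \<sigma> g ram_1_funpow ram_G by (intro b G_comp) auto
  have fq: "f q = f 0" using ram_1_exponent[OF g] by (simp add: f_def)
  have "{..q} = insert 0 (insert q {0<..<q})" using q0 by auto
  then have "(shift g ^^ q) b \<sigma> = (1 + (-1) ^ q) * f 0
      + (\<Sum>j\<in>{0<..<q}. of_nat (q choose j) * (-1) ^ (q - j) * f j)"
    unfolding eq using q0 fq by (simp add: algebra_simps)
  moreover have "ge 1 (\<Sum>j\<in>{0<..<q}. of_nat (q choose j) * (-1) ^ (q - j) * f j)"
  proof (rule ge_sum)
    fix j assume j: "j \<in> {0<..<q}"
    have "q dvd (q choose j)" using j prime_q by (intro dvd_choose_prime) auto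
    then obtain m where "q choose j = q * m" by (rule dvdE)
    then show "ge 1 (of_nat (q choose j) * (-1) ^ (q - j) * f j)"
      using ge_q f by (auto intro!: ge_mult_right ge_of_nat ge_power)
  qed
  \<comment> \<open>The two end terms cancel for odd \<open>q\<close>; for \<open>q = 2\<close> they
    add up to twice \<open>f 0\<close>, which lies in \<open>P\<close>.\<close>
  moreover have "ge 1 (1 + (-1) ^ q :: 'a)"
  proof (cases "even q")
    case True
    then have "q = 2" using prime_q by (metis primes_dvd_imp_eq two_is_prime_nat)
    then show ?thesis using ge_q by simp
  qed simp
  ultimately show ?thesis using f by (auto intro!: ge_add ge_mult_right)
qed

text \<open>Commuting nilpotent operators have a common nonzero kernel vector. For each new
  \<open>g\<close>, \<open>shift g\<close> is applied as long as the result stays nonzero modulo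
  \<open>P\<close>; commutativity preserves the invariance already reached.\<close>

lemma invariant_element:
  assumes J: "\<And>b \<sigma>. b \<in> J \<Longrightarrow> \<sigma> \<in> G \<Longrightarrow> ge 0 (b \<sigma>)" "\<And>b g. b \<in> J \<Longrightarrow> g \<in> ram 1 \<Longrightarrow> shift g b \<in> J"
    and b: "b \<in> J" "\<exists>\<sigma>\<in>G. \<not> ge 1 (b \<sigma>)"
  shows "\<exists>b\<in>J. (\<exists>\<sigma>\<in>G. \<not> ge 1 (b \<sigma>)) \<and> (\<forall>g\<in>ram 1. \<forall>\<sigma>\<in>G. ge 1 (shift g b \<sigma>))"
proof -
  have "\<exists>b\<in>J. (\<exists>\<sigma>\<in>G. \<not> ge 1 (b \<sigma>)) \<and> (\<forall>g\<in>S. \<forall>\<sigma>\<in>G. ge 1 (shift g b \<sigma>))"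
    if "finite S" "S \<subseteq> ram 1" for S
    using that
  proof (induction S rule: finite_induct)
    case empty
    then show ?case using b by auto
  next
    case (insert g S)
    then obtain b where b: "b \<in> J" "\<exists>\<sigma>\<in>G. \<not> ge 1 (b \<sigma>)" "\<And>h \<sigma>. h \<in> S \<Longrightarrow> \<sigma> \<in> G \<Longrightarrow> ge 1 (shift h b \<sigma>)"
      by auto
    have g: "g \<in> ram 1" and S: "S \<subseteq> ram 1" using insert.prems by auto
    define P where "P k \<longleftrightarrow> (\<forall>\<sigma>\<in>G. ge 1 ((shift g ^^ k) b \<sigma>))" for k
    have iter: "(shift g ^^ k) b \<in> J" for k by (induction k) (use b J(2) g in auto)
    have "P q" unfolding P_def using shift_nilpotent[OF g, of b] J(1)[OF b(1)] by blast
    moreover have "\<not> P 0" using b(2) by (simp add: P_def)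
    ultimately have "\<exists>k<q. (\<forall>i\<le>k. \<not> P i) \<and> P (Suc k)" by (rule ex_least_nat_less)
    then obtain k where k: "\<not> P k" "P (Suc k)" by auto
    have inv: "ge 1 (shift h ((shift g ^^ n) b) \<sigma>)" if h: "h \<in> S" and "\<sigma> \<in> G" for h n \<sigma>
      using that(2)
    proof (induction n arbitrary: \<sigma>)
      case 0
      then show ?case using b(3)[OF h] by simp
    next
      case (Suc n)
      have "h \<in> ram 1" using h S by blast
      then have eq: "shift h ((shift g ^^ Suc n) b) = shift g (shift h ((shift g ^^ n) b))"
        using shift_commute[OF _ g] by simp
      have "\<sigma> \<circ> g \<in> G" using Suc.prems g ram_G G_comp by blast
      from ge_diff[OF Suc.IH[OF this] Suc.IH[OF Suc.prems]]
      show ?case unfolding eq shift_def[of g "shift h _"] .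
    qed
    have "\<forall>h\<in>insert g S. \<forall>\<sigma>\<in>G. ge 1 (shift h ((shift g ^^ k) b) \<sigma>)"
    proof (intro ballI)
      fix h \<sigma> assume h: "h \<in> insert g S" and \<sigma>: "\<sigma> \<in> G"
      have "shift g ((shift g ^^ k) b) = (shift g ^^ Suc k) b" by simp
      then have "ge 1 (shift g ((shift g ^^ k) b) \<sigma>)" using k(2) \<sigma> unfolding P_def by metis
      then show "ge 1 (shift h ((shift g ^^ k) b) \<sigma>)" using h inv[OF _ \<sigma>] by blast
    qed
    moreover have "\<exists>\<sigma>\<in>G. \<not> ge 1 ((shift g ^^ k) b \<sigma>)" using k(1) unfolding P_def by blast
    ultimately show ?case using iter[of k] by (intro bexI[of _ "(shift g ^^ k) b"] conjI)
  qed
  then show ?thesis using subgroupD(5)[OF subgroup_ram] by blast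
qed

lemma group_ring_acts_faithfully:
  assumes b: "\<And>\<sigma>. \<sigma> \<in> G \<Longrightarrow> b \<sigma> \<in> K \<and> ge 0 (b \<sigma>)"
    and act: "\<And>x. ge 1 x \<Longrightarrow> ge (v p + 1) (\<Sum>\<sigma>\<in>G. b \<sigma> * \<sigma> x)"
    and \<sigma>: "\<sigma> \<in> G"
  shows "ge 1 (b \<sigma>)"
proof (rule ccontr)
  assume neg: "\<not> ge 1 (b \<sigma>)"
  note sub = subgroup_ram[of 1]
  \<comment> \<open>The annihilator of \<open>P / p P\<close> in the integral group ring. It is
    stable under \<open>shift g\<close> because \<open>inv g\<close> preserves
    \<open>P\<close>.\<close>
  define J where "J = {b. (\<forall>\<sigma>\<in>G. b \<sigma> \<in> K \<and> ge 0 (b \<sigma>)) \<and>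
    (\<forall>x. ge 1 x \<longrightarrow> ge (v p + 1) (\<Sum>\<sigma>\<in>G. b \<sigma> * \<sigma> x))}"
  have "\<exists>b\<in>J. (\<exists>\<sigma>\<in>G. \<not> ge 1 (b \<sigma>)) \<and> (\<forall>g\<in>ram 1. \<forall>\<sigma>\<in>G. ge 1 (shift g b \<sigma>))"
  proof (rule invariant_element)
    show "b \<in> J" using b act by (auto simp: J_def)
    show "\<exists>\<sigma>\<in>G. \<not> ge 1 (b \<sigma>)" using neg \<sigma> by blast
    show "ge 0 (b \<sigma>)" if "b \<in> J" "\<sigma> \<in> G" for b \<sigma> using that by (simp add: J_def)
    show "shift g b \<in> J" if c: "b \<in> J" and g: "g \<in> ram 1" for b g
    proof -
      have gG: "g \<in> G" using g ram_G by blast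
      have "ge (v p + 1) (\<Sum>\<sigma>\<in>G. shift g b \<sigma> * \<sigma> x)" if x: "ge 1 x" for x
      proof -
        have "(\<Sum>\<sigma>\<in>G. b (\<sigma> \<circ> g) * \<sigma> x) = (\<Sum>\<sigma>\<in>G. b \<sigma> * \<sigma> (inv g x))"
          by (rule sum.reindex_bij_witness[of _ "\<lambda>\<sigma>. \<sigma> \<circ> inv g" "\<lambda>\<sigma>. \<sigma> \<circ> g"])
            (use gG G_comp G_inv[OF gG] in \<open>auto simp: comp_assoc\<close>)
        then have "(\<Sum>\<sigma>\<in>G. shift g b \<sigma> * \<sigma> x) = (\<Sum>\<sigma>\<in>G. b \<sigma> * \<sigma> (inv g x)) - (\<Sum>\<sigma>\<in>G. b \<sigma> * \<sigma> x)"
          by (simp add: shift_def left_diff_distrib sum_subtractf)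
        moreover have "ge 1 (inv g x)" using x G_inv[OF gG] by simp
        ultimately show ?thesis using c x by (simp add: J_def ge_diff)
      qed
      moreover have "shift g b \<sigma> \<in> K \<and> ge 0 (shift g b \<sigma>)" if "\<sigma> \<in> G" for \<sigma>
        using c that G_comp[OF that gG] by (simp add: J_def shift_def K_diff ge_diff)
      ultimately show ?thesis by (simp add: J_def)
    qed
  qed
  then obtain b where bJ: "b \<in> J" and nz: "\<exists>\<sigma>\<in>G. \<not> ge 1 (b \<sigma>)"
    and inv: "\<And>g \<sigma>. g \<in> ram 1 \<Longrightarrow> \<sigma> \<in> G \<Longrightarrow> ge 1 (b (\<sigma> \<circ> g) - b \<sigma>)"
    unfolding shift_def by blast
  have bK: "\<And>\<sigma>. \<sigma> \<in> G \<Longrightarrow> b \<sigma> \<in> K" and b0: "\<And>\<sigma>. \<sigma> \<in> G \<Longrightarrow> ge 0 (b \<sigma>)"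
    and bact: "\<And>x. ge 1 x \<Longrightarrow> ge (v p + 1) (\<Sum>\<sigma>\<in>G. b \<sigma> * \<sigma> x)"
    using bJ by (auto simp: J_def)
  obtain R where R: "R \<subseteq> G" "bij_betw (\<lambda>(r, h). r \<circ> h) (R \<times> ram 1) G"
    using transversal_exists[OF sub subgroup_G] subgroupD(1)[OF sub] by blast
  obtain y where y: "(\<Sum>h\<in>ram 1. h y) = 1" "ge (1 - int (card (ram 1))) y"
    using trace_one[OF sub ram_antimono[of 0 1]] by auto
  define U where "U = {w. w \<noteq> 0 \<and> (\<forall>h\<in>ram 1. h w = w)}"
  have small: "ge (v p + 1) (\<Sum>r\<in>R. b r * r w)" if w: "w \<in> U" "0 < v w" for w
  proof -
    define x where "x = w * y"
    \<comment> \<open>This exactly offsets the lower bound \<open>1 - card (ram 1)\<close> on the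
      valuation of \<open>y\<close>, placing \<open>w * y\<close> in \<open>P\<close>.\<close>
    have "int (card (ram 1)) \<le> v w"
      using w ram_1_ram_0 subgroupD(5)[OF sub] by (intro card_le_v_fixed) (auto simp: U_def)
    then have x: "ge 1 x"
      using ge_mult[OF _ y(2), of "v w" w] w(1) unfolding x_def
      by (auto simp: vge_def[of v "v w"] elim!: ge_mono)
    have "(\<Sum>h\<in>ram 1. b (r \<circ> h) * (r \<circ> h) x) = b r * r w + (\<Sum>h\<in>ram 1. (b (r \<circ> h) - b r) * r (h x))"
      if "r \<in> R" for r
    proof -
      have rG: "r \<in> G" using that R(1) by blast
      have hx: "h x = w * h y" if h: "h \<in> ram 1" for h
      proof -
        have "h \<in> G" "h w = w" using h w(1) ram_G by (auto simp: U_def)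
        then show ?thesis by (simp add: x_def G_mult)
      qed
      have "(\<Sum>h\<in>ram 1. b r * r (h x)) = (\<Sum>h\<in>ram 1. b r * (r w * r (h y)))"
        by (intro sum.cong refl) (simp only: hx G_mult[OF rG])
      also have "\<dots> = b r * (r w * r (\<Sum>h\<in>ram 1. h y))" by (simp add: G_sum[OF rG] sum_distrib_left)
      also have "\<dots> = b r * r w" by (simp add: y(1) G_1[OF rG])
      finally have "(\<Sum>h\<in>ram 1. b r * r (h x)) = b r * r w" .
      then show ?thesis by (simp add: left_diff_distrib sum_subtractf)
    qed
    then have eq: "(\<Sum>\<sigma>\<in>G. b \<sigma> * \<sigma> x)
        = (\<Sum>r\<in>R. b r * r w) + (\<Sum>r\<in>R. \<Sum>h\<in>ram 1. (b (r \<circ> h) - b r) * r (h x))"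
      by (simp add: transversal_sum[OF R(2)] sum.distrib cong: sum.cong)
    \<comment> \<open>Replacing \<open>b (r \<circ> h)\<close> by \<open>b r\<close> costs an
      element of \<open>P\<close>; as the coefficients lie in \<open>K\<close> it is a multiple of
      \<open>p\<close>, and the factor \<open>r (h x)\<close> supplies the missing one.\<close>
    have err: "ge (v p + 1) (\<Sum>r\<in>R. \<Sum>h\<in>ram 1. (b (r \<circ> h) - b r) * r (h x))"
    proof (intro ge_sum ge_mult)
      fix r h assume "r \<in> R" "h \<in> ram 1"
      then have G: "r \<in> G" "h \<in> G" "r \<circ> h \<in> G" using R(1) ram_G G_comp by blast+
      show "ge 1 (r (h x))" using G x by simp
      show "ge (v p) (b (r \<circ> h) - b r)"
        using G bK inv[OF \<open>h \<in> ram 1\<close> G(1)] by (intro K_ge_1_imp K_diff) auto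
    qed
    show ?thesis using ge_diff[OF bact[OF x] err] unfolding eq by simp
  qed
  have rel: "ge 1 (\<Sum>r\<in>R. b r * (r w / w))" if w: "w \<in> U" for w
  proof -
    text \<open>Multiplying \<open>w\<close> by a power of \<open>p\<close> moves its valuation into \<open>{1..v p}\<close> without
      affecting the quotients \<open>r w / w\<close>.\<close>
    define k where "k = (v w - 1) div v p"
    define u where "u = (if k \<ge> 0 then 1 / p ^ nat k else p ^ nat (- k))"
    have u: "u \<noteq> 0" "u \<in> K" "v u = - (k * v p)"
      using p_K by (auto simp: u_def v_divide v_power intro!: K_divide K_1 K_power)
    define w' where "w' = u * w"
    have w': "w' \<in> U" using w u ram_G by (auto simp: w'_def U_def G_mult G_fix)
    have "v w' - 1 = (v w - 1) mod v p"
      using w u by (simp add: w'_def U_def v_mult k_def minus_div_mult_eq_mod[symmetric])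
    then have vw': "0 < v w'" "v w' \<le> v p"
      using pos_mod_bound[OF v_p, of "v w - 1"] pos_mod_sign[OF v_p, of "v w - 1"] by linarith+
    have "ge (v p + 1 - v w') ((\<Sum>r\<in>R. b r * r w') / w')"
      using small[OF w' vw'(1)] w' by (intro ge_divide) (auto simp: U_def)
    then have "ge 1 ((\<Sum>r\<in>R. b r * r w') / w')" by (rule ge_mono) (use vw' in simp)
    moreover have "(\<Sum>r\<in>R. b r * r w') / w' = (\<Sum>r\<in>R. b r * (r w / w))"
      unfolding sum_divide_distrib
      using R(1) u by (intro sum.cong) (auto simp: w'_def G_mult G_fix)
    ultimately show ?thesis by simp
  qed
  have "ge 1 (b r)" if r: "r \<in> R" for r
  proof (rule characters_independent[where U = U and \<chi> = "\<lambda>r w. r w / w" and I = R and b = b])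
    show "finite R" using R(1) finite_G finite_subset by blast
    have "1 \<in> U" using ram_G G_1 by (auto simp: U_def)
    then show "U \<noteq> {}" by blast
    show "x * z \<in> U" if "x \<in> U" "z \<in> U" for x z
      using that ram_G by (auto simp: U_def G_mult)
    show "ge 0 (s x / x) \<and> \<not> ge 1 (s x / x)" if "s \<in> R" "x \<in> U" for s x
    proof -
      have "s \<in> G" "x \<noteq> 0" using that R(1) by (auto simp: U_def)
      then show ?thesis by (simp add: vge_def v_divide v_G G_eq_0_iff)
    qed
    show "s (x * z) / (x * z) = s x / x * (s z / z)" if "s \<in> R" for s x z
    proof -
      have "s \<in> G" using that R(1) by blast
      then show ?thesis by (simp add: G_mult)
    qed
    show "\<exists>x\<in>U. \<not> ge 1 (s x / x - t x / x)" if st: "s \<in> R" "t \<in> R" "s \<noteq> t" for s t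
    proof (rule ccontr)
      assume "\<not> ?thesis"
      then have cong: "ge 1 (s x / x - t x / x)" if "x \<in> U" for x using that by blast
      have sG: "s \<in> G" and tG: "t \<in> G" using st R(1) by auto
      \<comment> \<open>Congruent characters would put both representatives into the same coset of
        \<open>ram 1\<close>.\<close>
      have "inv s \<circ> t \<in> ram 1"
      proof (rule ram_1_detect)
        show "inv s \<circ> t \<in> G" using sG tG by (intro G_comp G_inv)
        fix w assume w: "w \<noteq> 0" "\<forall>h\<in>ram 1. h w = w"
        then have "ge 1 (s w / w - t w / w)" using cong by (auto simp: U_def)
        then have "ge (1 + v w) ((s w / w - t w / w) * w)" using w by (intro ge_mult) (auto simp: vge_def)
        then have "ge (1 + v w) (s w - t w)" using w by (simp add: left_diff_distrib)
        then have "ge (1 + v w) (t w - s w)" using ge_minus_commute by blast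
        then have "ge (1 + v w) (inv s (t w - s w))" using G_inv[OF sG] by simp
        then have "ge (1 + v w) (inv s (t w) - w)" using sG G_inv[OF sG] by (simp add: G_diff)
        then have "ge (1 + v w - v w) ((inv s (t w) - w) / w)" using w by (intro ge_divide)
        then show "ge 1 ((inv s \<circ> t) w / w - 1)" using w by (simp add: diff_divide_distrib)
      qed
      then show False using transversal_distinct[OF R(2,1) sub st(1,2)] st(3) by blast
    qed
    show "ge 0 (b s)" if "s \<in> R" for s using that R(1) b0 by blast
  qed (use rel r in auto)
  moreover obtain \<tau> where \<tau>: "\<tau> \<in> G" "\<not> ge 1 (b \<tau>)" using nz by blast
  obtain r h where rh: "r \<in> R" "h \<in> ram 1" "\<tau> = r \<circ> h" using transversal_cover[OF R(2) \<tau>(1)] .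
  moreover have "ge 1 (b (r \<circ> h) - b r)" using rh R(1) inv by blast
  ultimately show False using \<tau>(2) ge_add[of 1 "b (r \<circ> h) - b r" "b r"] by auto
qed

subsection \<open>The associated order\<close>

text \<open>Every \<open>\<sigma>\<close> fixes the coefficients of \<open>b\<close>, so it commutes
  with multiplication by them.\<close>

lemma grp_act_mult:
  assumes "\<And>\<sigma>. \<sigma> \<in> G \<Longrightarrow> b \<sigma> \<in> K"
  shows "grp_act G (grp_mult G a b) x = grp_act G a (grp_act G b x)"
proof -
  have "grp_act G (grp_mult G a b) x = (\<Sum>\<tau>\<in>G. \<Sum>\<sigma>\<in>G. a \<sigma> * (b (inv \<sigma> \<circ> \<tau>) * \<tau> x))"
    by (simp add: grp_act_def grp_mult_def sum_distrib_right mult.assoc)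
  also have "\<dots> = (\<Sum>\<sigma>\<in>G. \<Sum>\<tau>\<in>G. a \<sigma> * (b (inv \<sigma> \<circ> \<tau>) * \<tau> x))" by (rule sum.swap)
  also have "\<dots> = (\<Sum>\<sigma>\<in>G. a \<sigma> * \<sigma> (grp_act G b x))"
  proof (intro sum.cong refl)
    fix \<sigma> assume \<sigma>: "\<sigma> \<in> G"
    have "(\<Sum>\<tau>\<in>G. b (inv \<sigma> \<circ> \<tau>) * \<tau> x) = (\<Sum>\<tau>\<in>G. b (inv \<sigma> \<circ> (\<sigma> \<circ> \<tau>)) * (\<sigma> \<circ> \<tau>) x)"
      using subgroup_sum_shift[OF subgroup_G \<sigma>, of "\<lambda>\<tau>. b (inv \<sigma> \<circ> \<tau>) * \<tau> x"] by (rule sym)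
    also have "\<dots> = (\<Sum>\<tau>\<in>G. \<sigma> (b \<tau> * \<tau> x))"
    proof (intro sum.cong refl)
      fix \<tau> assume "\<tau> \<in> G"
      moreover have "inv \<sigma> \<circ> (\<sigma> \<circ> \<tau>) = \<tau>" using \<sigma> by (simp add: comp_assoc[symmetric])
      ultimately show "b (inv \<sigma> \<circ> (\<sigma> \<circ> \<tau>)) * (\<sigma> \<circ> \<tau>) x = \<sigma> (b \<tau> * \<tau> x)"
        using assms by (simp add: G_mult[OF \<sigma>] G_fix[OF \<sigma>])
    qed
    also have "\<dots> = \<sigma> (grp_act G b x)" by (simp add: grp_act_def G_sum[OF \<sigma>])
    finally show "(\<Sum>\<tau>\<in>G. a \<sigma> * (b (inv \<sigma> \<circ> \<tau>) * \<tau> x)) = a \<sigma> * \<sigma> (grp_act G b x)"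
      by (simp add: sum_distrib_left[symmetric])
  qed
  finally show ?thesis by (simp add: grp_act_def)
qed

lemma grp_act_add: "grp_act G (\<lambda>\<sigma>. a \<sigma> + b \<sigma>) x = grp_act G a x + grp_act G b x"
  by (simp add: grp_act_def distrib_right sum.distrib)

lemma grp_act_scale: "grp_act G (\<lambda>\<sigma>. c * a \<sigma>) x = c * grp_act G a x"
  by (simp add: grp_act_def sum_distrib_left mult.assoc)

lemma grp_act_scaled_trace: "grp_act G (scaled_trace p (ram 0)) x = inverse p * (\<Sum>h\<in>ram 0. h x)"
proof -
  have "grp_act G (scaled_trace p (ram 0)) x = (\<Sum>\<sigma>\<in>G. if \<sigma> \<in> ram 0 then inverse p * \<sigma> x else 0)"
    unfolding grp_act_def scaled_trace_def by (intro sum.cong) auto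
  also have "\<dots> = (\<Sum>\<sigma>\<in>G \<inter> ram 0. inverse p * \<sigma> x)"
    using finite_G by (simp add: sum.inter_restrict)
  also have "G \<inter> ram 0 = ram 0" using ram_G by blast
  finally show ?thesis by (simp add: sum_distrib_left)
qed

abbreviation OKG where "OKG \<equiv> grp_ring (K \<inter> val_ring v) G"

abbreviation trace_alg where "trace_alg \<equiv> gen_alg G OKG (scaled_trace p (ram 0))"

lemma assoc_orderD:
  assumes "a \<in> assoc_order v K"
  shows "\<And>\<sigma>. \<sigma> \<in> G \<Longrightarrow> a \<sigma> \<in> K" "\<And>\<sigma>. \<sigma> \<notin> G \<Longrightarrow> a \<sigma> = 0" "\<And>x. ge 0 x \<Longrightarrow> ge 0 (grp_act G a x)"
  using assms by (auto simp: assoc_order_def grp_ring_def)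

lemma trace_alg_subset: "trace_alg \<subseteq> assoc_order v K"
proof
  fix a assume "a \<in> trace_alg"
  then show "a \<in> assoc_order v K"
  proof (induction rule: gen_alg.induct)
    case (base a)
    then show ?case
      by (auto simp: assoc_order_def grp_ring_def grp_act_def intro!: ge_sum ge_mult_left)
  next
    case gen
    have "ge 0 (grp_act G (scaled_trace p (ram 0)) x)" if x: "ge 0 x" for x
      using ge_divide[OF p_nz trace_ram_0[OF x]]
      by (simp add: grp_act_scaled_trace divide_inverse mult.commute)
    then show ?case
      using K_0 K_inverse[OF p_K] ram_G by (auto simp: assoc_order_def grp_ring_def scaled_trace_def)
  next
    case (add a b)
    then show ?case
      by (auto simp: assoc_order_def grp_ring_def grp_act_add intro!: ge_add K_add)
  next
    case (mult a b)
    note a = assoc_orderD[OF mult.IH(1)] and b = assoc_orderD[OF mult.IH(2)]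
    have "grp_mult G a b \<tau> \<in> K" if "\<tau> \<in> G" for \<tau>
      using a(1) b(1) that G_comp[OF G_inv] by (auto simp: grp_mult_def intro!: K_sum K_mult)
    moreover have "ge 0 (grp_act G (grp_mult G a b) x)" if "ge 0 x" for x
      using grp_act_mult[of b a x] a(3) b(1,3) that by simp
    ultimately show ?case by (auto simp: assoc_order_def grp_ring_def grp_mult_def)
  qed
qed

text \<open>Denominators are lowered one power of \<open>p\<close> at a time. If
  \<open>p ^ (n + 2) * a\<close> is integral, it maps \<open>P\<close> into \<open>p P\<close>, so
  faithfulness makes it divisible by \<open>p\<close>. The descent ends at exponent one, since
  \<open>p O\<close> is not contained in \<open>p P\<close>.\<close>

lemma p_mult_assoc_order_integral:
  assumes a: "a \<in> assoc_order v K" and \<sigma>: "\<sigma> \<in> G"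
  shows "ge 0 (p * a \<sigma>)"
proof -
  note aK = assoc_orderD(1)[OF a] and a0 = assoc_orderD(3)[OF a]
  have descend: "\<forall>\<sigma>\<in>G. ge 0 (p ^ Suc n * a \<sigma>) \<Longrightarrow> \<forall>\<sigma>\<in>G. ge 0 (p * a \<sigma>)" for n
  proof (induction n)
    case (Suc n)
    have "ge 0 (p ^ Suc n * a \<sigma>)" if \<sigma>: "\<sigma> \<in> G" for \<sigma>
    proof -
      have "ge 1 (p ^ Suc (Suc n) * a \<sigma>)"
      proof (rule group_ring_acts_faithfully[where b = "\<lambda>\<sigma>. p ^ Suc (Suc n) * a \<sigma>"])
        show "p ^ Suc (Suc n) * a \<sigma> \<in> K \<and> ge 0 (p ^ Suc (Suc n) * a \<sigma>)" if "\<sigma> \<in> G" for \<sigma>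
          using Suc.prems aK that by (auto intro!: K_mult K_power p_K)
        fix x assume "ge 1 x"
        then have "ge 0 (grp_act G a x)" using a0 ge_mono[of 1 x 0] by simp
        moreover have "ge (v p + 1) (p ^ Suc (Suc n))"
        proof -
          have "0 \<le> int n * v p" using v_p by simp
          moreover have "int (Suc (Suc n)) * v p = 2 * v p + int n * v p" by (simp add: algebra_simps)
          ultimately have "v p + 1 \<le> int (Suc (Suc n)) * v p" using v_p by linarith
          then show ?thesis by (simp add: vge_def v_power del: power_Suc)
        qed
        ultimately have "ge (v p + 1) (p ^ Suc (Suc n) * grp_act G a x)" by (intro ge_mult_right)
        then show "ge (v p + 1) (\<Sum>\<sigma>\<in>G. p ^ Suc (Suc n) * a \<sigma> * \<sigma> x)"
          unfolding grp_act_def by (simp only: sum_distrib_left mult.assoc)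
      qed (rule \<sigma>)
      then have "ge (v p) (p ^ Suc (Suc n) * a \<sigma>)"
        by (intro K_ge_1_imp K_mult K_power p_K aK \<sigma>)
      then have "ge (0 + v p) (p * (p ^ Suc n * a \<sigma>))" by (simp add: mult.assoc)
      then show ?thesis by (rule ge_mult_cancel[OF p_nz])
    qed
    then show ?case using Suc.IH by blast
  qed simp
  define n where "n = nat (\<Sum>\<sigma>\<in>G. \<bar>v (a \<sigma>)\<bar>)"
  have "ge 0 (p ^ Suc n * a \<sigma>)" if "\<sigma> \<in> G" for \<sigma>
  proof (cases "a \<sigma> = 0")
    case False
    have "\<bar>v (a \<sigma>)\<bar> \<le> (\<Sum>\<sigma>\<in>G. \<bar>v (a \<sigma>)\<bar>)" using that finite_G by (intro member_le_sum) auto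
    then have "- v (a \<sigma>) \<le> int (Suc n) * 1" by (simp add: n_def)
    also have "int (Suc n) * 1 \<le> int (Suc n) * v p" using v_p by (intro mult_left_mono) simp_all
    finally show ?thesis using False by (simp add: vge_def v_mult v_power del: power_Suc)
  qed simp
  then show ?thesis using descend \<sigma> by blast
qed

text \<open>The inertia group acts trivially modulo \<open>p P\<close> on \<open>p O\<close>, so faithfulness makes the
  reduction of \<open>p * a\<close> invariant under left translation by inertia, hence a multiple of its trace.\<close>

lemma assoc_order_inertia_cong:
  assumes a: "a \<in> assoc_order v K" and h: "h \<in> ram 0" and \<sigma>: "\<sigma> \<in> G"
  shows "ge 0 (a (h \<circ> \<sigma>) - a \<sigma>)"
proof -
  note aK = assoc_orderD(1)[OF a] and a0 = assoc_orderD(3)[OF a]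
  define k where "k = inv h"
  have hG: "h \<in> G" using h ram_G by blast
  have kG: "k \<in> G" and k0: "k \<in> ram 0" using h hG subgroupD(4)[OF subgroup_ram] G_inv by (auto simp: k_def)
  have hk: "h \<circ> (k \<circ> \<tau>) = \<tau>" for \<tau> using hG by (simp add: k_def comp_assoc[symmetric])
  \<comment> \<open>The coefficients of the group ring element
    \<open>p * (inv h - 1) * a\<close>.\<close>
  define b where "b \<tau> = p * a (h \<circ> \<tau>) - p * a \<tau>" for \<tau>
  have bK: "b \<tau> \<in> K \<and> ge 0 (b \<tau>)" if "\<tau> \<in> G" for \<tau>
    unfolding b_def using that G_comp[OF hG that]
    by (intro conjI K_diff K_mult p_K aK ge_diff p_mult_assoc_order_integral[OF a])
  have "ge 1 (b \<sigma>)"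
  proof (rule group_ring_acts_faithfully[OF bK _ \<sigma>])
    fix x assume "ge 1 x"
    then have y: "ge 0 (grp_act G a x)" using a0 ge_mono[of 1 x 0] by simp
    have "(\<Sum>\<tau>\<in>G. a (h \<circ> \<tau>) * \<tau> x) = (\<Sum>\<tau>\<in>G. a (h \<circ> (k \<circ> \<tau>)) * (k \<circ> \<tau>) x)"
      using subgroup_sum_shift[OF subgroup_G kG, of "\<lambda>\<tau>. a (h \<circ> \<tau>) * \<tau> x"] by (rule sym)
    also have "\<dots> = k (grp_act G a x)"
      unfolding hk grp_act_def G_sum[OF kG] using aK by (intro sum.cong) (auto simp: G_mult[OF kG] G_fix[OF kG])
    finally have "(\<Sum>\<tau>\<in>G. b \<tau> * \<tau> x) = p * (k (grp_act G a x) - grp_act G a x)"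
      by (simp add: b_def grp_act_def left_diff_distrib right_diff_distrib sum_subtractf mult.assoc sum_distrib_left[symmetric])
    moreover have "ge (v p + (0 + 1)) (p * (k (grp_act G a x) - grp_act G a x))"
      using ram_ge[OF k0 y] by (intro ge_mult) (auto simp: vge_def[of v "v p"])
    ultimately show "ge (v p + 1) (\<Sum>\<tau>\<in>G. b \<tau> * \<tau> x)" by simp
  qed
  then have "ge (v p) (b \<sigma>)" using bK[OF \<sigma>] by (intro K_ge_1_imp) auto
  then have "ge (0 + v p) (p * (a (h \<circ> \<sigma>) - a \<sigma>))" by (simp add: b_def right_diff_distrib)
  then show ?thesis by (rule ge_mult_cancel[OF p_nz])
qed

text \<open>With \<open>c\<close> equal to \<open>p * a\<close> on coset representatives of inertia,
  the product of \<open>c\<close> and the scaled trace takes the value \<open>a r\<close> on the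
  whole coset of \<open>r\<close>. What remains of \<open>a\<close> is integral.\<close>

lemma assoc_order_eq: "assoc_order v K = trace_alg"
proof (rule antisym[OF subsetI trace_alg_subset])
  fix a assume a: "a \<in> assoc_order v K"
  note aK = assoc_orderD(1)[OF a] and az = assoc_orderD(2)[OF a]
  note sub = subgroup_ram[of 0]
  let ?t = "scaled_trace p (ram 0)"
  obtain R where R: "R \<subseteq> G" "bij_betw (\<lambda>(r, h). r \<circ> h) (R \<times> ram 0) G"
    using transversal_exists[OF sub subgroup_G] subgroupD(1)[OF sub] by blast
  have finR: "finite R" using R(1) finite_G finite_subset by blast
  define c where "c \<sigma> = (if \<sigma> \<in> R then p * a \<sigma> else 0)" for \<sigma>
  have c: "c \<in> OKG"
    using R(1) aK p_mult_assoc_order_integral[OF a]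
    by (auto simp: c_def grp_ring_def intro!: K_0 K_mult p_K)
  define d where "d \<sigma> = a \<sigma> - grp_mult G c ?t \<sigma>" for \<sigma>
  have ct: "grp_mult G c ?t (r \<circ> h) = a r" if rh: "r \<in> R" "h \<in> ram 0" for r h
  proof -
    have rG: "r \<in> G" and hG: "h \<in> G" using rh R(1) ram_G by blast+
    have summand: "c \<sigma> * ?t (inv \<sigma> \<circ> (r \<circ> h)) = (if \<sigma> = r then a r else 0)" if \<sigma>: "\<sigma> \<in> G" for \<sigma>
    proof (cases "\<sigma> = r")
      case True
      have "inv r \<circ> (r \<circ> h) = h" using rG by (simp add: comp_assoc[symmetric])
      then show ?thesis using True rh by (simp add: c_def scaled_trace_def)
    next
      case False
      have "\<sigma> \<notin> R \<or> inv \<sigma> \<circ> (r \<circ> h) \<notin> ram 0"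
      proof (rule ccontr)
        assume "\<not> ?thesis"
        then have s: "\<sigma> \<in> R" "inv \<sigma> \<circ> (r \<circ> h) \<in> ram 0" by auto
        have "(inv \<sigma> \<circ> (r \<circ> h)) \<circ> inv h = inv \<sigma> \<circ> r" using hG by (simp add: comp_assoc)
        then have "inv \<sigma> \<circ> r \<in> ram 0" using subgroupD(3)[OF sub s(2) subgroupD(4)[OF sub rh(2)]] by simp
        then show False using transversal_distinct[OF R(2,1) sub s(1) rh(1)] False by blast
      qed
      then show ?thesis using False by (auto simp: c_def scaled_trace_def)
    qed
    have "grp_mult G c ?t (r \<circ> h) = (\<Sum>\<sigma>\<in>G. c \<sigma> * ?t (inv \<sigma> \<circ> (r \<circ> h)))"
      using G_comp[OF rG hG] unfolding grp_mult_def by (simp only: if_True)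
    also have "\<dots> = (\<Sum>\<sigma>\<in>G. if \<sigma> = r then a r else 0)" by (intro sum.cong refl summand)
    also have "\<dots> = a r" using rG finite_G by simp
    finally show ?thesis .
  qed
  have "d \<tau> \<in> K \<and> ge 0 (d \<tau>)" if \<tau>: "\<tau> \<in> G" for \<tau>
  proof -
    obtain r h where rh: "r \<in> R" "h \<in> ram 0" "\<tau> = r \<circ> h" using transversal_cover[OF R(2) \<tau>] .
    have rG: "r \<in> G" using rh R(1) by blast
    \<comment> \<open>Normality of inertia turns right translation by \<open>h\<close> into left
      translation by a conjugate, where the congruence is available.\<close>
    have "(r \<circ> h \<circ> inv r) \<circ> r = \<tau>" using rG by (simp add: comp_assoc rh(3))
    then have "ge 0 (a \<tau> - a r)"
      using assoc_order_inertia_cong[OF a ram_conj[OF rG rh(2)] rG] by simp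
    moreover have "d \<tau> = a \<tau> - a r" using ct[OF rh(1,2)] by (simp only: d_def rh(3))
    ultimately show ?thesis using aK \<tau> rG by (simp add: K_diff)
  qed
  then have "d \<in> OKG" using az by (auto simp: grp_ring_def d_def grp_mult_def)
  then have "(\<lambda>\<sigma>. d \<sigma> + grp_mult G c ?t \<sigma>) \<in> trace_alg"
    using c by (intro gen_alg.add gen_alg.mult gen_alg.base gen_alg.gen)
  then show "a \<in> trace_alg" by (simp add: d_def)
qed

text \<open>Multiplication by \<open>p\<close> carries the associated order into \<open>OKG\<close>,
  which gives injectivity. For surjectivity, \<open>x\<close> is split into a part in
  \<open>P\<close>, reached by \<open>OKG\<close>, and a Teichmueller representative, which is the
  scaled trace of an element of \<open>P\<close>.\<close>

lemma free_generator_assoc_order: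
  assumes \<alpha>: "free_generator G OKG (val_ideal v) \<alpha>"
  shows "free_generator G (assoc_order v K) (val_ring v) \<alpha>"
proof -
  have inj: "inj_on (\<lambda>a. grp_act G a \<alpha>) OKG" and im: "(\<lambda>a. grp_act G a \<alpha>) ` OKG = val_ideal v"
    using \<alpha> by (auto simp: free_generator_def bij_betw_def)
  have "(\<lambda>\<sigma>. if \<sigma> = id then 1 else 0) \<in> OKG" using G_id K_0 K_1 by (auto simp: grp_ring_def)
  moreover have "grp_act G (\<lambda>\<sigma>. if \<sigma> = id then 1 else 0) \<alpha> = (\<Sum>\<sigma>\<in>G. if \<sigma> = id then \<alpha> else 0)"
    unfolding grp_act_def by (intro sum.cong) auto
  then have "grp_act G (\<lambda>\<sigma>. if \<sigma> = id then 1 else 0) \<alpha> = \<alpha>" using G_id finite_G by simp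
  ultimately have "\<alpha> \<in> val_ideal v" using im by force
  then have \<alpha>0: "ge 0 \<alpha>" using ge_mono[of 1 \<alpha> 0] by simp
  show ?thesis
    unfolding free_generator_def
  proof (rule bij_betw_imageI)
    show "inj_on (\<lambda>a. grp_act G a \<alpha>) (assoc_order v K)"
    proof (rule inj_onI)
      fix a b assume a: "a \<in> assoc_order v K" and b: "b \<in> assoc_order v K"
        and eq: "grp_act G a \<alpha> = grp_act G b \<alpha>"
      have "(\<lambda>\<sigma>. p * c \<sigma>) \<in> OKG" if "c \<in> assoc_order v K" for c
        using assoc_orderD(1,2)[OF that] p_mult_assoc_order_integral[OF that]
        by (auto simp: grp_ring_def intro!: K_mult p_K)
      then have "(\<lambda>\<sigma>. p * a \<sigma>) = (\<lambda>\<sigma>. p * b \<sigma>)"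
        using inj a b eq by (intro inj_onD[OF inj]) (auto simp: grp_act_scale)
      then show "a = b" by (simp add: fun_eq_iff)
    qed
    show "(\<lambda>a. grp_act G a \<alpha>) ` assoc_order v K = val_ring v"
    proof (intro antisym subsetI)
      fix x assume "x \<in> (\<lambda>a. grp_act G a \<alpha>) ` assoc_order v K"
      then show "x \<in> val_ring v" using assoc_orderD(3) \<alpha>0 by auto
    next
      fix x assume "x \<in> val_ring v"
      then obtain \<omega> where \<omega>: "ge 0 \<omega>" "ge 1 (x - \<omega>)" "\<And>\<sigma>. \<sigma> \<in> ram 0 \<Longrightarrow> \<sigma> \<omega> = \<omega>"
        using teichmueller[of x] by auto
      obtain y where y: "(\<Sum>h\<in>ram 0. h y) = 1" "ge (1 - int (card (ram 1))) y"
        using trace_one[OF subgroup_ram subset_refl] by blast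
      \<comment> \<open>Inertia fixes \<open>\<omega>\<close> and \<open>p\<close>, and
        \<open>y\<close> has trace one, so the scaled trace of \<open>z\<close> is
        \<open>\<omega>\<close>. The bound \<open>card (ram 1) \<le> v p\<close> puts
        \<open>p * y\<close> into \<open>P\<close>.\<close>
      define z where "z = \<omega> * (p * y)"
      have "\<forall>h\<in>ram 1. h p = p" using ram_G G_fix p_K by blast
      then have "int (card (ram 1)) \<le> v p"
        using v_p ram_1_ram_0 subgroupD(5)[OF subgroup_ram] by (intro card_le_v_fixed) auto
      moreover have "ge (v p + (1 - int (card (ram 1)))) (p * y)"
        using y(2) by (intro ge_mult) (auto simp: vge_def[of v "v p"])
      ultimately have "ge 1 (p * y)" using ge_mono by fastforce
      then have z: "ge 1 z" unfolding z_def using \<omega>(1) by (simp add: ge_mult_left)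
      have "(\<Sum>h\<in>ram 0. h z) = (\<Sum>h\<in>ram 0. \<omega> * (p * h y))"
      proof (intro sum.cong refl)
        fix h assume h: "h \<in> ram 0"
        then have hG: "h \<in> G" using ram_G by blast
        show "h z = \<omega> * (p * h y)"
          by (simp add: z_def G_mult[OF hG] \<omega>(3)[OF h] G_fix[OF hG p_K])
      qed
      also have "\<dots> = \<omega> * (p * (\<Sum>h\<in>ram 0. h y))" by (simp add: sum_distrib_left)
      finally have tz: "grp_act G (scaled_trace p (ram 0)) z = \<omega>"
        by (simp add: grp_act_scaled_trace y(1))
      obtain b c where b: "b \<in> OKG" "x - \<omega> = grp_act G b \<alpha>" and c: "c \<in> OKG" "z = grp_act G c \<alpha>"
        using \<omega>(2) z im by (metis (no_types, lifting) imageE mem_val_ideal)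
      let ?a = "\<lambda>\<sigma>. b \<sigma> + grp_mult G (scaled_trace p (ram 0)) c \<sigma>"
      have "?a \<in> assoc_order v K"
        unfolding assoc_order_eq using b(1) c(1)
        by (intro gen_alg.add gen_alg.mult gen_alg.base gen_alg.gen)
      moreover have "grp_act G ?a \<alpha> = x"
        using c(1) tz by (simp add: grp_act_add grp_act_mult grp_ring_def b(2)[symmetric] c(2)[symmetric])
      ultimately show "x \<in> (\<lambda>a. grp_act G a \<alpha>) ` assoc_order v K" by force
    qed
  qed
qed

end

theorem theorem1p2:
  fixes v :: "'a::field \<Rightarrow> int" and K :: "'a set" and p :: 'a
  assumes "local_field_val v"
    and "local_subfield v K"
    and "galois_ext K"
    and "wildly_ramified v K"
    and "weakly_ramified v K"
    and "uniformizer v K p"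
  shows "assoc_order v K =
           gen_alg (Gal K) (grp_ring (K \<inter> val_ring v) (Gal K)) (scaled_trace p (ram_group v K 0))
         \<and> (\<forall>\<alpha>. free_generator (Gal K) (grp_ring (K \<inter> val_ring v) (Gal K)) (val_ideal v) \<alpha>
               \<longrightarrow> free_generator (Gal K) (assoc_order v K) (val_ring v) \<alpha>)"
proof -
  interpret weak_extension v K p
    using assms
    by unfold_locales
      (auto simp: local_field_val_def local_subfield_def galois_ext_def wildly_ramified_def weakly_ramified_def)
  show ?thesis using assoc_order_eq free_generator_assoc_order by blast
qed

end
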